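(* Let $k$ be a field and let $r \geq 3$ and $d \geq 2$ be integers. Then $\mathrm{in}(I_{G_{r,d}})$ has linear quotients with respect to the ordered minimal generating set $\{m_1,\ldots,m_{\frac{d(d+1)}{2}}\}$. Furthermore, \[(n_1,\ldots,n_{\frac{d(d+1)}{2}}) = (0,\underbrace{1,1}_{2},\underbrace{2,2,2}_{3},\ldots,\underbrace{d-2,\ldots,d-2}_{d-1},\underbrace{d-1,\ldots,d-1}_{d}),\] (that is, for $q=1,\ldots,d$ in order, the value $q-1$ is repeated $q$ times), where $n_p$ is the minimal number of generators of the ideal $\langle m_1,\ldots,m_{p-1}\rangle : \langle m_p\rangle$.
   Context: For a finite simple graph $G$ with vertices $V(G)$ and edges $E(G)$, let $k[V(G)]$ and $k[E(G)]$ be the polynomial rings over a field $k$ whose variables are the vertices, respectively the edges, of $G$. The toric ideal $I_G \subseteq k[E(G)]$ is the kernel of the $k$-algebra homomorphism $\phi_G: k[E(G)] \to k[V(G)]$ sending the variable of each edge $e=\{x,x'\}$ to $x x'$. For integers $r\geq 3$, $d \geq 2$, the graph $G_{r,d}$ has vertex set $\{x_1,x_2,y_1,\ldots,y_d,z_1,\ldots,z_{2r-3}\}$ and edges: $a_i=\{x_1,y_i\}$ and $b_i=\{x_2,y_i\}$ for $1\leq i\leq d$; $e_1=\{x_1,z_1\}$; $e_i=\{z_{i-1},z_i\}$ for $2\leq i\leq 2r-3$; and $e_{2r-2}=\{z_{2r-3},x_2\}$. $\mathrm{in}(I_{G_{r,d}})$ denotes the initial ideal of $I_{G_{r,d}}$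 with respect to the graded reverse lexicographic order $>$ on $k[E(G_{r,d})]$ with $a_1>\cdots>a_d>e_1>\cdots>e_{2r-2}>b_1>\cdots>b_d$. Its unique minimal monomial generating set is $F_d\cup H_{r,d}$, where $F_d=\{a_ib_j \mid 1\leq j<i\leq d\}$ and $H_{r,d}=\{a_ie_2e_4\cdots e_{2r-2}\mid 1\leq i\leq d\}$; it has $\frac{d(d+1)}{2}$ elements. The elements of this set, listed from least to greatest with respect to $>$, are denoted $m_1,\ldots,m_{\frac{d(d+1)}{2}}$. Explicitly the list is \[a_db_{d-1};\ a_db_{d-2}, a_{d-1}b_{d-2};\ a_db_{d-3},a_{d-1}b_{d-3},a_{d-2}b_{d-3};\ \ldots;\ a_db_1,a_{d-1}b_1,\ldots,a_2b_1;\] \[a_de_2e_4\cdots e_{2r-2},\ a_{d-1}e_2e_4\cdots e_{2r-2},\ \ldots,\ a_1e_2e_4\cdots e_{2r-2}.\] A homogeneous ideal $I$ with an ordered minimal set of homogeneous generators $\{f_1,\ldots,f_m\}$ has linear quotients with respect to $\{f_1,\ldots,f_m\}$ if each ideal quotient $\langle f_1,\ldots,f_{j-1}\rangle:\langle f_j\rangle$, $j=2,\ldots,m$, is generated by linear forms. For $p=1$ the ideal $\langle m_1,\ldots,m_{p-1}\rangle$ is the zero ideal. *)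

theory Defs
  imports "HOL-Algebra.RingHom" "HOL-Library.Poly_Mapping"
begin

section \<open>Polynomial rings in a set of variables\<close>

type_synonym 'v mono = "'v \<Rightarrow>\<^sub>0 nat"
type_synonym ('v, 'k) mpoly = "'v mono \<Rightarrow>\<^sub>0 'k"

definition monom :: "'v mono \<Rightarrow> ('v, 'k::field) mpoly" where
  "monom t = Poly_Mapping.single t 1"

definition Const :: "'k \<Rightarrow> ('v, 'k::field) mpoly" where
  "Const c = Poly_Mapping.single 0 c"

definition Var :: "'v \<Rightarrow> ('v, 'k::field) mpoly" where
  "Var v = monom (Poly_Mapping.single v 1)"

text \<open>The variables are a subset \<open>V\<close> of the type \<open>'v\<close>, so that the number of variables
  may depend on natural number parameters; ideals are ideals of this ring (and not of the ring of
  all polynomials over the type \<open>'v\<close>).\<close>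

definition poly_ring :: "'v set \<Rightarrow> ('v, 'k::field) mpoly ring" where
  "poly_ring V =
    \<lparr>carrier = {p. \<forall>t \<in> Poly_Mapping.keys p. Poly_Mapping.keys t \<subseteq> V},
     mult = (*), one = 1, zero = 0, add = (+)\<rparr>"

lemma poly_ring_simps [simp]:
  "p \<in> carrier (poly_ring V) \<longleftrightarrow> (\<forall>t \<in> Poly_Mapping.keys p. Poly_Mapping.keys t \<subseteq> V)"
  "p \<otimes>\<^bsub>poly_ring V\<^esub> q = p * q" "p \<oplus>\<^bsub>poly_ring V\<^esub> q = p + q"
  "\<one>\<^bsub>poly_ring V\<^esub> = 1" "\<zero>\<^bsub>poly_ring V\<^esub> = 0"
  by (simp_all add: poly_ring_def)

lemma poly_ring_cring: "cring (poly_ring V :: ('v, 'k::field) mpoly ring)"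
proof (rule cringI)
  show "abelian_group (poly_ring V :: ('v, 'k) mpoly ring)"
  proof (rule abelian_groupI)
    fix x y :: "('v, 'k) mpoly"
    assume "x \<in> carrier (poly_ring V)" "y \<in> carrier (poly_ring V)"
    then show "x \<oplus>\<^bsub>poly_ring V\<^esub> y \<in> carrier (poly_ring V)"
      using Poly_Mapping.keys_add[of x y] by auto
  next
    fix x :: "('v, 'k) mpoly"
    assume "x \<in> carrier (poly_ring V)"
    then show "\<exists>y \<in> carrier (poly_ring V). y \<oplus>\<^bsub>poly_ring V\<^esub> x = \<zero>\<^bsub>poly_ring V\<^esub>"
      by (intro bexI[of _ "- x"]) (auto simp: in_keys_iff)
  qed (auto simp: algebra_simps)
  show "comm_monoid (poly_ring V :: ('v, 'k) mpoly ring)"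
  proof (rule comm_monoidI)
    fix x y :: "('v, 'k) mpoly"
    assume *: "x \<in> carrier (poly_ring V)" "y \<in> carrier (poly_ring V)"
    show "x \<otimes>\<^bsub>poly_ring V\<^esub> y \<in> carrier (poly_ring V)"
    proof (simp, intro ballI)
      fix t assume "t \<in> Poly_Mapping.keys (x * y)"
      then obtain a b where "t = a + b" "a \<in> Poly_Mapping.keys x" "b \<in> Poly_Mapping.keys y"
        using keys_mult[of x y] by blast
      then show "Poly_Mapping.keys t \<subseteq> V"
        using * Poly_Mapping.keys_add[of a b] unfolding poly_ring_simps(1) by blast
    qed
  qed (auto simp: algebra_simps)
qed (auto simp: algebra_simps)

definition mdeg :: "'v mono \<Rightarrow> nat" where
  "mdeg t = (\<Sum>v \<in> Poly_Mapping.keys t. Poly_Mapping.lookup t v)"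

definition is_homogeneous :: "('v, 'k::field) mpoly \<Rightarrow> bool" where
  "is_homogeneous f \<longleftrightarrow> (\<exists>n. \<forall>t \<in> Poly_Mapping.keys f. mdeg t = n)"

definition linear_forms :: "'v set \<Rightarrow> ('v, 'k::field) mpoly set" where
  "linear_forms V = {f \<in> carrier (poly_ring V). \<forall>t \<in> Poly_Mapping.keys f. mdeg t = 1}"


section \<open>Minimal generators, ideal quotients, linear quotients\<close>

definition minimal_gen_set :: "('a, 'b) ring_scheme \<Rightarrow> 'a set \<Rightarrow> 'a set \<Rightarrow> bool" where
  "minimal_gen_set R I S \<longleftrightarrow>
     S \<subseteq> carrier R \<and> Idl\<^bsub>R\<^esub> S = I \<and> (\<forall>T. T \<subset> S \<longrightarrow> Idl\<^bsub>R\<^esub> T \<noteq> I)"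

definition min_num_gens :: "('a, 'b) ring_scheme \<Rightarrow> 'a set \<Rightarrow> nat" where
  "min_num_gens R I = (LEAST n. \<exists>S \<subseteq> carrier R. finite S \<and> card S = n \<and> Idl\<^bsub>R\<^esub> S = I)"

definition ideal_quotient :: "('a, 'b) ring_scheme \<Rightarrow> 'a set \<Rightarrow> 'a set \<Rightarrow> 'a set" where
  "ideal_quotient R I J = {g \<in> carrier R. \<forall>h \<in> J. g \<otimes>\<^bsub>R\<^esub> h \<in> I}"

text \<open>\<open>step_quotient R fs j\<close> is \<open>\<langle>f\<^sub>1, \<dots>, f\<^sub>j\<^sub>-\<^sub>1\<rangle> : \<langle>f\<^sub>j\<rangle>\<close>, where \<open>j\<close> starts at 1 although list
  positions start at 0.\<close>

definition step_quotient :: "('a, 'b) ring_scheme \<Rightarrow> 'a list \<Rightarrow> nat \<Rightarrow> 'a set" where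
  "step_quotient R fs j =
     ideal_quotient R (Idl\<^bsub>R\<^esub> (set (take (j - 1) fs))) (Idl\<^bsub>R\<^esub> {fs ! (j - 1)})"

definition has_linear_quotients ::
    "'v set \<Rightarrow> ('v, 'k::field) mpoly set \<Rightarrow> ('v, 'k) mpoly list \<Rightarrow> bool" where
  "has_linear_quotients V I fs \<longleftrightarrow>
     distinct fs \<and> minimal_gen_set (poly_ring V) I (set fs) \<and> (\<forall>f \<in> set fs. is_homogeneous f) \<and>
     (\<forall>j \<in> {2..length fs}. \<exists>L \<subseteq> linear_forms V.
        step_quotient (poly_ring V) fs j = Idl\<^bsub>poly_ring V\<^esub> L)"


section \<open>Monomial orders and initial ideals\<close>

text \<open>The list \<open>vs\<close> contains the variables in decreasing order.\<close>

definition grevlex_less :: "'v list \<Rightarrow> 'v mono \<Rightarrow> 'v mono \<Rightarrow> bool" where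
  "grevlex_less vs s t \<longleftrightarrow>
     mdeg s < mdeg t \<or>
     mdeg s = mdeg t \<and>
       (\<exists>i < length vs. Poly_Mapping.lookup s (vs ! i) > Poly_Mapping.lookup t (vs ! i) \<and>
          (\<forall>j. i < j \<and> j < length vs \<longrightarrow>
             Poly_Mapping.lookup s (vs ! j) = Poly_Mapping.lookup t (vs ! j)))"

definition is_leading_mono :: "('v mono \<Rightarrow> 'v mono \<Rightarrow> bool) \<Rightarrow> ('v, 'k::field) mpoly \<Rightarrow> 'v mono \<Rightarrow> bool"
  where "is_leading_mono lt p t \<longleftrightarrow>
    t \<in> Poly_Mapping.keys p \<and> (\<forall>s \<in> Poly_Mapping.keys p. s \<noteq> t \<longrightarrow> lt s t)"

definition initial_ideal ::
    "'v set \<Rightarrow> ('v mono \<Rightarrow> 'v mono \<Rightarrow> bool) \<Rightarrow> ('v, 'k::field) mpoly set \<Rightarrow> ('v, 'k) mpoly set" where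
  "initial_ideal V lt I =
     Idl\<^bsub>poly_ring V\<^esub> {monom t | t. \<exists>p \<in> I. is_leading_mono lt p t}"

text \<open>The minimal monomial generators of a monomial ideal, listed from least to greatest. The
  description is proper when \<open>V\<close> is finite and \<open>lt\<close> is a monomial order: the set of minimal
  monomial generators of a monomial ideal is unique and finite, and a total order lists it in only
  one way.\<close>

definition sorted_mono_gens ::
    "'v set \<Rightarrow> ('v mono \<Rightarrow> 'v mono \<Rightarrow> bool) \<Rightarrow> ('v, 'k::field) mpoly set \<Rightarrow> ('v, 'k) mpoly list" where
  "sorted_mono_gens V lt I =
     map monom (THE ts. sorted_wrt lt ts \<and> minimal_gen_set (poly_ring V) I (monom ` set ts))"


section \<open>Toric ideals of graphs\<close>

text \<open>A finite simple graph is given by its vertex set and its set of edges, which are two-element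
  sets of vertices; the edges themselves are the variables of \<open>k[E(G)]\<close>.\<close>

definition simple_graph :: "'v set \<Rightarrow> 'v set set \<Rightarrow> bool" where
  "simple_graph V E \<longleftrightarrow> finite V \<and> (\<forall>e \<in> E. e \<subseteq> V \<and> card e = 2)"

definition toric_map :: "('v set, 'k::field) mpoly \<Rightarrow> ('v, 'k) mpoly" where
  "toric_map p = (\<Sum>t \<in> Poly_Mapping.keys p.
     Const (Poly_Mapping.lookup p t) *
       (\<Prod>e \<in> Poly_Mapping.keys t. (\<Prod>v \<in> e. Var v) ^ Poly_Mapping.lookup t e))"

lemma toric_map_sum:
  assumes "finite K" "Poly_Mapping.keys p \<subseteq> K"
  shows "toric_map p = (\<Sum>t \<in> K. Const (Poly_Mapping.lookup p t) *
    (\<Prod>e \<in> Poly_Mapping.keys t. (\<Prod>v \<in> e. Var v) ^ Poly_Mapping.lookup t e))"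
  unfolding toric_map_def using assms
  by (intro sum.mono_neutral_left) (auto simp: Const_def in_keys_iff)

lemma toric_map_add: "toric_map (p + q) = toric_map p + toric_map q"
proof -
  let ?K = "Poly_Mapping.keys p \<union> Poly_Mapping.keys q"
  have "Poly_Mapping.keys (p + q) \<subseteq> ?K" by (rule Poly_Mapping.keys_add)
  then show ?thesis
    by (simp add: toric_map_sum[of ?K] lookup_add Const_def single_add
        distrib_right sum.distrib)
qed

lemma toric_map_zero: "toric_map 0 = 0"
  by (simp add: toric_map_def)

lemma toric_map_one: "toric_map 1 = 1"
  by (simp add: toric_map_def Const_def lookup_one)

lemma toric_map_Var: "toric_map (Var e) = (\<Prod>v \<in> e. Var v)"
  by (simp add: toric_map_def Var_def[of e] monom_def Const_def single_one flip: mult.assoc)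

lemma toric_map_single_mult:
  fixes c c' :: "'k::field" and s t :: "'v set mono"
  shows "toric_map (Poly_Mapping.single s c * Poly_Mapping.single t c') =
   toric_map (Poly_Mapping.single s c) * toric_map (Poly_Mapping.single t c')"
proof -
  define mu :: "'v set mono \<Rightarrow> ('v, 'k) mpoly" where
    "mu t = (\<Prod>e \<in> Poly_Mapping.keys t. (\<Prod>v \<in> e. Var v) ^ Poly_Mapping.lookup t e)" for t
  have mu_sup: "mu t = (\<Prod>e \<in> K. (\<Prod>v \<in> e. Var v) ^ Poly_Mapping.lookup t e)"
    if "finite K" "Poly_Mapping.keys t \<subseteq> K" for t K
    unfolding mu_def using that by (intro prod.mono_neutral_left) (auto simp: in_keys_iff)
  have mu_add: "mu (s + t) = mu s * mu t"
    using mu_sup[of "Poly_Mapping.keys s \<union> Poly_Mapping.keys t"] Poly_Mapping.keys_add[of s t]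
    by (simp add: lookup_add power_add prod.distrib)
  have single: "toric_map (Poly_Mapping.single t c) = Const c * mu t" for t and c :: 'k
    by (simp add: toric_map_def mu_def Const_def)
  have C: "Const (c * c') = (Const c * Const c' :: ('v, 'k) mpoly)"
    by (simp add: Const_def mult_single)
  show ?thesis
    unfolding mult_single single mu_add C by (simp only: ac_simps)
qed

lemma mpoly_induct [case_names zero add]:
  fixes p :: "('v, 'k::field) mpoly"
  assumes "P 0" "\<And>t c p. P p \<Longrightarrow> P (Poly_Mapping.single t c + p)"
  shows "P p"
proof (induction p rule: update_induct)
  case const
  show ?case by (rule assms)
next
  case (update f a b)
  have "Poly_Mapping.update a b f = Poly_Mapping.single a b + f"
    using update(1) by (intro poly_mapping_eqI)
      (auto simp: lookup_update lookup_add lookup_single in_keys_iff)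
  then show ?case using assms(2) update(3) by simp
qed

lemma toric_map_mult: "toric_map (p * q) = toric_map p * toric_map q"
proof (induction p rule: mpoly_induct)
  case zero
  show ?case by (simp add: toric_map_zero)
next
  case (add t c p)
  have "toric_map (Poly_Mapping.single t c * q) = toric_map (Poly_Mapping.single t c) * toric_map q"
    by (induction q rule: mpoly_induct)
      (simp_all add: toric_map_zero toric_map_add toric_map_single_mult distrib_left)
  then show ?case by (simp add: add toric_map_add distrib_right)
qed

lemma Var_in_poly_ring: "v \<in> V \<Longrightarrow> Var v \<in> carrier (poly_ring V)"
  by (simp add: Var_def monom_def)

lemma toric_map_closed:
  assumes "p \<in> carrier (poly_ring E)" and E: "\<And>e. e \<in> E \<Longrightarrow> e \<subseteq> V"
  shows "toric_map p \<in> carrier (poly_ring V)"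
proof -
  interpret cring "poly_ring V :: ('a, 'b) mpoly ring" by (rule poly_ring_cring)
  note [simp del] = poly_ring_simps(1)
  have prodI: "prod f A \<in> carrier (poly_ring V)"
    if "\<And>x. x \<in> A \<Longrightarrow> f x \<in> carrier (poly_ring V)" for f :: "'c \<Rightarrow> ('a, 'b) mpoly" and A
    using that one_closed m_closed by (induction A rule: infinite_finite_induct) auto
  have sumI: "sum f A \<in> carrier (poly_ring V)"
    if "\<And>x. x \<in> A \<Longrightarrow> f x \<in> carrier (poly_ring V)" for f :: "'c \<Rightarrow> ('a, 'b) mpoly" and A
    using that zero_closed a_closed by (induction A rule: infinite_finite_induct) auto
  have powI: "f ^ n \<in> carrier (poly_ring V)"
    if "f \<in> carrier (poly_ring V)" for f :: "('a, 'b) mpoly" and n :: nat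
    using that one_closed m_closed by (induction n) auto
  have C: "Const c \<in> carrier (poly_ring V)" for c :: 'b
    by (simp add: Const_def poly_ring_simps(1))
  show ?thesis
    unfolding toric_map_def
  proof (intro sumI)
    fix t assume "t \<in> Poly_Mapping.keys p"
    then have "Poly_Mapping.keys t \<subseteq> E" using assms(1) by (simp add: poly_ring_simps(1))
    then have "(\<Prod>e \<in> Poly_Mapping.keys t. (\<Prod>v \<in> e. Var v) ^ Poly_Mapping.lookup t e)
        \<in> carrier (poly_ring V :: ('a, 'b) mpoly ring)"
      using E by (intro prodI powI Var_in_poly_ring) blast
    with C show "Const (Poly_Mapping.lookup p t) *
        (\<Prod>e \<in> Poly_Mapping.keys t. (\<Prod>v \<in> e. Var v) ^ Poly_Mapping.lookup t e)
        \<in> carrier (poly_ring V)"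
      using m_closed by simp
  qed
qed

lemma toric_map_ring_hom:
  assumes "simple_graph V E"
  shows "toric_map \<in> ring_hom (poly_ring E) (poly_ring V)"
proof (rule ring_hom_memI)
  fix p :: "('a set, 'b) mpoly"
  assume "p \<in> carrier (poly_ring E)"
  then show "toric_map p \<in> carrier (poly_ring V)"
    using assms by (intro toric_map_closed[of p E V]) (auto simp: simple_graph_def)
qed (simp_all add: toric_map_add toric_map_mult toric_map_one)

definition toric_ideal :: "'v set \<Rightarrow> 'v set set \<Rightarrow> ('v set, 'k::field) mpoly set" where
  "toric_ideal V E = a_kernel (poly_ring E) (poly_ring V :: ('v, 'k) mpoly ring) toric_map"


section \<open>The graphs \<open>G\<^sub>r\<^sub>,\<^sub>d\<close>\<close>

datatype vertex = X nat | Y nat | Z nat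

definition edge_a :: "nat \<Rightarrow> vertex set" where
  "edge_a i = {X 1, Y i}"

definition edge_b :: "nat \<Rightarrow> vertex set" where
  "edge_b i = {X 2, Y i}"

definition edge_e :: "nat \<Rightarrow> nat \<Rightarrow> vertex set" where
  "edge_e r i =
     (if i = 1 then {X 1, Z 1}
      else if i = 2 * r - 2 then {Z (2 * r - 3), X 2}
      else {Z (i - 1), Z i})"

definition G_vertices :: "nat \<Rightarrow> nat \<Rightarrow> vertex set" where
  "G_vertices r d = {X 1, X 2} \<union> Y ` {1..d} \<union> Z ` {1..2 * r - 3}"

definition G_edges :: "nat \<Rightarrow> nat \<Rightarrow> vertex set set" where
  "G_edges r d = edge_a ` {1..d} \<union> edge_b ` {1..d} \<union> edge_e r ` {1..2 * r - 2}"

lemma G_simple_graph: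
  assumes "r \<ge> 3"
  shows "simple_graph (G_vertices r d) (G_edges r d)"
  unfolding simple_graph_def
proof (intro conjI ballI)
  show "finite (G_vertices r d)" by (simp add: G_vertices_def)
  fix e assume "e \<in> G_edges r d"
  then consider i where "i \<in> {1..d}" "e = edge_a i \<or> e = edge_b i"
    | i where "i \<in> {1..2 * r - 2}" "e = edge_e r i"
    by (auto simp: G_edges_def)
  then have "e \<subseteq> G_vertices r d \<and> card e = 2"
  proof cases
    case 1
    then show ?thesis by (auto simp: edge_a_def edge_b_def G_vertices_def)
  next
    case 2
    then show ?thesis using assms
      by (auto simp: edge_e_def G_vertices_def image_iff card_insert_if)
  qed
  then show "e \<subseteq> G_vertices r d" "card e = 2" by auto
qed

text \<open>The graded reverse lexicographic order with
  \<open>a\<^sub>1 > \<dots> > a\<^sub>d > e\<^sub>1 > \<dots> > e\<^sub>2\<^sub>r\<^sub>-\<^sub>2 > b\<^sub>1 > \<dots> > b\<^sub>d\<close>.\<close>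

definition G_less :: "nat \<Rightarrow> nat \<Rightarrow> vertex set mono \<Rightarrow> vertex set mono \<Rightarrow> bool" where
  "G_less r d = grevlex_less
     (map edge_a [1..<Suc d] @ map (edge_e r) [1..<Suc (2 * r - 2)] @ map edge_b [1..<Suc d])"

definition in_I :: "nat \<Rightarrow> nat \<Rightarrow> (vertex set, 'k::field) mpoly set" where
  "in_I r d = initial_ideal (G_edges r d) (G_less r d) (toric_ideal (G_vertices r d) (G_edges r d))"

definition gens_in_I :: "nat \<Rightarrow> nat \<Rightarrow> (vertex set, 'k::field) mpoly list" where
  "gens_in_I r d = sorted_mono_gens (G_edges r d) (G_less r d) (in_I r d)"

end

theory Submission
  imports Defs "HOL.Vector_Spaces"
begin

text \<open>
  The toric ideal is the kernel of a map that sends monomials to monomials, so it is governed by the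
  fibres of that map on monomials: a monomial leads an element of the ideal exactly if some
  monomial of its fibre is smaller (\<open>initial_ideal_toric_eq\<close>). A fibre is cut out by degree conditions at
  the vertices. If a monomial \<open>t\<close> has a smaller companion in its fibre, the last edge with a changed
  exponent is some \<open>b\<^sub>i\<close>, and the degree conditions then show that \<open>t\<close> is divisible by some \<open>a\<^sub>i b\<^sub>j\<close> with
  \<open>j < i\<close> or by \<open>a\<^sub>i e\<^sub>2 e\<^sub>4 \<dots> e\<^sub>2\<^sub>r\<^sub>-\<^sub>2\<close> (\<open>nonminimal_divisible\<close>). Conversely these monomials lead the binomials
  of the even cycles of the graph (\<open>mono_image_partner\<close>, \<open>partner_less\<close>). This determines the initial
  ideal.

  With \<open>c\<^sub>j = b\<^sub>j\<close> for \<open>j \<ge> 1\<close> and \<open>c\<^sub>0 = e\<^sub>2 e\<^sub>4 \<dots> e\<^sub>2\<^sub>r\<^sub>-\<^sub>2\<close> the generators are uniformly \<open>a\<^sub>i c\<^sub>j\<close> for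
  \<open>0 \<le> j < i \<le> d\<close>, and the increasing order lists them by decreasing \<open>j\<close>, then by decreasing \<open>i\<close>. The
  generators before \<open>a\<^sub>i c\<^sub>j\<close> with the same \<open>j\<close> put the variables \<open>a\<^sub>i\<^sub>'\<close> with \<open>i' > i\<close> into the quotient, those with
  the same \<open>i\<close> put in the variables \<open>b\<^sub>j\<^sub>'\<close> with \<open>j < j' < i\<close>, and all others contribute only multiples of these
  (\<open>divisible_iff_quotient_var\<close>). Hence the quotient is generated by
  \<open>(d - i) + (i - j - 1) = d - j - 1\<close> variables. An ideal generated by \<open>n\<close> variables needs \<open>n\<close> generators,
  as the linear parts of generators must span the space of those variables
  (\<open>min_num_gens_variables\<close>). The \<open>d - j\<close> generators with a given \<open>j\<close> are consecutive, so \<open>q = d - j\<close>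
  gives the stated sequence.
\<close>

abbreviation (input) lookup where "lookup \<equiv> Poly_Mapping.lookup"
abbreviation (input) keys where "keys \<equiv> Poly_Mapping.keys"
abbreviation (input) single where "single \<equiv> Poly_Mapping.single"

section \<open>Monomials\<close>

definition mdvd :: "'v mono \<Rightarrow> 'v mono \<Rightarrow> bool" where
  "mdvd s t \<longleftrightarrow> (\<forall>v. lookup s v \<le> lookup t v)"

lemma mdvd_refl: "mdvd t t"
  by (simp add: mdvd_def)

lemma mdvd_trans: "mdvd s t \<Longrightarrow> mdvd t u \<Longrightarrow> mdvd s u"
  unfolding mdvd_def by (meson order_trans)

lemma mdvd_antisym: "mdvd s t \<Longrightarrow> mdvd t s \<Longrightarrow> s = t"
  by (auto simp: mdvd_def intro!: poly_mapping_eqI antisym)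

lemma mdvd_add: "mdvd s t \<Longrightarrow> mdvd s (u + t)"
  by (auto simp: mdvd_def lookup_add intro: trans_le_add2)

lemma mdvd_diff_add: "mdvd s t \<Longrightarrow> (t - s) + s = t"
  by (auto simp: mdvd_def lookup_add lookup_minus intro!: poly_mapping_eqI)

lemma mdvd_single_iff: "mdvd (single v 1) t \<longleftrightarrow> v \<in> keys t"
  by (auto simp: mdvd_def lookup_single in_keys_iff when_def Suc_le_eq)

lemma keys_monom [simp]: "keys (monom t :: ('v, 'k::field) mpoly) = {t}"
  by (simp add: monom_def)

lemma inj_monom: "inj (monom :: 'v mono \<Rightarrow> ('v, 'k::field) mpoly)"
  by (metis injI keys_monom singleton_inject)

lemma monom_add: "monom (s + t) = (monom s * monom t :: ('v, 'k::field) mpoly)"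
  by (simp add: monom_def mult_single)

lemma monom_zero: "monom 0 = (1 :: ('v, 'k::field) mpoly)"
  by (simp add: monom_def)

lemma monom_sum: "monom (sum f A) = (\<Prod>x\<in>A. monom (f x) :: ('v, 'k::field) mpoly)"
  by (induction A rule: infinite_finite_induct) (simp_all add: monom_zero monom_add)

lemma mdeg_eq_sum: "finite K \<Longrightarrow> keys t \<subseteq> K \<Longrightarrow> mdeg t = (\<Sum>v\<in>K. lookup t v)"
  unfolding mdeg_def by (intro sum.mono_neutral_left) (auto simp: in_keys_iff)

lemma mdeg_add: "mdeg (s + t) = mdeg s + mdeg t"
  using mdeg_eq_sum[of "keys s \<union> keys t"] Poly_Mapping.keys_add[of s t]
  by (simp add: lookup_add sum.distrib)

lemma mdeg_single [simp]: "mdeg (single v n) = n"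
  by (simp add: mdeg_def)

lemma mdeg_sum: "mdeg (sum f A) = (\<Sum>x\<in>A. mdeg (f x))"
proof -
  have "mdeg 0 = 0" by (simp add: mdeg_def)
  then show ?thesis by (induction A rule: infinite_finite_induct) (simp_all add: mdeg_add)
qed

lemma mpoly_eq_sum_singles: "p = (\<Sum>t\<in>keys p. single t (lookup p t))"
  by (rule poly_mapping_eqI) (simp add: lookup_sum lookup_single when_def in_keys_iff)

lemma lookup_single_mult:
  fixes p :: "('v, 'k::field) mpoly"
  shows "lookup (single t c * p) u = (if mdvd t u then c * lookup p (u - t) else 0)"
proof (induction p rule: mpoly_induct)
  case zero
  show ?case by simp
next
  case (add s e p)
  have "t + s = u \<longleftrightarrow> mdvd t u \<and> s = u - t"
    by (metis add_diff_cancel_left' mdvd_add mdvd_diff_add mdvd_refl add.commute)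
  then show ?case
    by (simp add: distrib_left lookup_add add mult_single lookup_single when_def)
qed

lemma keys_mult_monom: "keys (p * monom u :: ('v, 'k::field) mpoly) = (\<lambda>t. t + u) ` keys p"
proof -
  have "lookup (p * monom u) t = (if mdvd u t then lookup p (t - u) else 0)" for t
    using lookup_single_mult[of u 1 p t] by (simp add: monom_def mult.commute)
  then have "t \<in> keys (p * monom u) \<longleftrightarrow> mdvd u t \<and> t - u \<in> keys p" for t
    by (simp add: in_keys_iff)
  moreover have "mdvd u t \<and> t - u \<in> keys p \<longleftrightarrow> t \<in> (\<lambda>t. t + u) ` keys p" for t
  proof
    assume "mdvd u t \<and> t - u \<in> keys p"
    then show "t \<in> (\<lambda>t. t + u) ` keys p" using mdvd_diff_add[of u t] by (intro image_eqI[of _ _ "t - u"]) auto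
  qed (auto simp: mdvd_add mdvd_refl)
  ultimately show ?thesis by blast
qed

section \<open>Monomial ideals\<close>

lemma poly_ring_idealI:
  fixes J :: "('v, 'k::field) mpoly set"
  assumes J: "J \<subseteq> carrier (poly_ring V)" "0 \<in> J"
    and add: "\<And>f g. f \<in> J \<Longrightarrow> g \<in> J \<Longrightarrow> f + g \<in> J"
    and mult: "\<And>f g. f \<in> J \<Longrightarrow> g \<in> carrier (poly_ring V) \<Longrightarrow> g * f \<in> J"
  shows "ideal J (poly_ring V)"
proof -
  interpret cring "poly_ring V :: ('v, 'k) mpoly ring" by (rule poly_ring_cring)
  note [simp del] = poly_ring_simps(1)
  show ?thesis
  proof (rule idealI[OF ring_axioms])
    show "subgroup J (add_monoid (poly_ring V))"
    proof (rule group.subgroupI[OF a_group])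
      fix f assume f: "f \<in> J"
      then have "\<ominus>\<^bsub>poly_ring V\<^esub> f = \<ominus>\<^bsub>poly_ring V\<^esub> \<one>\<^bsub>poly_ring V\<^esub> \<otimes>\<^bsub>poly_ring V\<^esub> f"
        using J l_minus[of "\<one>\<^bsub>poly_ring V\<^esub>" f] one_closed by auto
      also have "\<dots> \<in> J"
        unfolding poly_ring_simps(2) by (rule mult[OF f a_inv_closed[OF one_closed]])
      finally show "inv\<^bsub>add_monoid (poly_ring V)\<^esub> f \<in> J"
        by (simp add: a_inv_def)
    qed (use J add in auto)
    show "x \<otimes>\<^bsub>poly_ring V\<^esub> a \<in> J" "a \<otimes>\<^bsub>poly_ring V\<^esub> x \<in> J"
      if "a \<in> J" "x \<in> carrier (poly_ring V)" for a x
      using mult[OF that] by (simp_all add: mult.commute)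
  qed
qed

lemma monoms_subset_carrier:
  "\<forall>m\<in>M. keys m \<subseteq> V \<Longrightarrow> monom ` M \<subseteq> carrier (poly_ring V :: ('v, 'k::field) mpoly ring)"
  by auto

text \<open>The right-hand side is an ideal containing the generators, and each of its elements is the sum of
  its terms, every one of which is a multiple of a generator. All later questions about monomial
  ideals reduce to divisibility through this description.\<close>

lemma Idl_monom:
  assumes M: "\<forall>m\<in>M. keys m \<subseteq> V"
  shows "Idl\<^bsub>poly_ring V\<^esub> (monom ` M :: ('v, 'k::field) mpoly set) =
    {p \<in> carrier (poly_ring V). \<forall>t \<in> keys p. \<exists>m \<in> M. mdvd m t}" (is "?I = ?J")
proof
  interpret R: cring "poly_ring V :: ('v, 'k) mpoly ring" by (rule poly_ring_cring)
  have carr: "monom ` M \<subseteq> carrier (poly_ring V :: ('v, 'k) mpoly ring)"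
    using M by (rule monoms_subset_carrier)
  show "?I \<subseteq> ?J"
  proof (rule R.genideal_minimal)
    show "ideal ?J (poly_ring V)"
    proof (rule poly_ring_idealI)
      fix f g :: "('v, 'k) mpoly"
      assume f: "f \<in> ?J" and g: "g \<in> carrier (poly_ring V)"
      have "\<exists>m \<in> M. mdvd m t" if "t \<in> keys (g * f)" for t
        using that keys_mult[of g f] f mdvd_add by blast
      moreover have "g * f \<in> carrier (poly_ring V)"
        using R.m_closed[of g f] f g by (simp del: poly_ring_simps(1))
      ultimately show "g * f \<in> ?J" by blast
    next
      fix f g :: "('v, 'k) mpoly"
      assume "f \<in> ?J" "g \<in> ?J"
      then show "f + g \<in> ?J"
        using Poly_Mapping.keys_add[of f g] unfolding mem_Collect_eq poly_ring_simps(1) by blast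
    qed auto
    show "monom ` M \<subseteq> ?J"
    proof clarify
      fix m assume "m \<in> M"
      then show "monom m \<in> carrier (poly_ring V) \<and> (\<forall>t \<in> keys (monom m :: ('v, 'k) mpoly). \<exists>m \<in> M. mdvd m t)"
        using M mdvd_refl by (simp; blast)
    qed
  qed
  interpret I: ideal ?I "poly_ring V" by (rule R.genideal_ideal[OF carr])
  show "?J \<subseteq> ?I"
  proof
    fix p assume p: "p \<in> ?J"
    have single: "single t c \<in> ?I" if t: "t \<in> keys p" for t and c :: 'k
    proof -
      obtain m where m: "m \<in> M" "mdvd m t" using p t by blast
      have "single (t - m) c \<in> carrier (poly_ring V)"
      proof -
        have "keys (t - m) \<subseteq> keys t" by (auto simp: in_keys_iff lookup_minus)
        then show ?thesis using p t by auto
      qed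
      moreover have "monom m \<in> ?I" using R.genideal_self[OF carr] m by blast
      ultimately have "single (t - m) c * monom m \<in> ?I"
        using I.I_l_closed by (simp del: poly_ring_simps(1))
      also have "single (t - m) c * monom m = single t c"
        using m by (simp add: monom_def mult_single mdvd_diff_add)
      finally show ?thesis .
    qed
    have "(\<Sum>t\<in>K. single t (lookup p t)) \<in> ?I" if "finite K" "K \<subseteq> keys p" for K
      using that
    proof (induction K)
      case empty
      show ?case using I.zero_closed by simp
    next
      case (insert t K)
      then show ?case using I.a_closed single by simp
    qed
    from this[of "keys p"] show "p \<in> ?I"
      using mpoly_eq_sum_singles[of p] by simp
  qed
qed

lemma monom_in_Idl_iff:
  assumes "\<forall>m\<in>M. keys m \<subseteq> V"
  shows "monom t \<in> Idl\<^bsub>poly_ring V\<^esub> (monom ` M :: ('v, 'k::field) mpoly set) \<longleftrightarrow>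
    keys t \<subseteq> V \<and> (\<exists>m \<in> M. mdvd m t)"
  by (subst Idl_monom[OF assms]) auto

lemma minimal_gen_setD:
  assumes "minimal_gen_set R I S"
  shows "S \<subseteq> carrier R" "Idl\<^bsub>R\<^esub> S = I" "T \<subset> S \<Longrightarrow> Idl\<^bsub>R\<^esub> T \<noteq> I"
  using assms by (simp_all add: minimal_gen_set_def)

text \<open>A generator left out is divisible by none of the remaining ones, so it is lost from the ideal.\<close>

lemma antichain_minimal_gen_set:
  assumes M: "\<forall>m\<in>M. keys m \<subseteq> V"
    and anti: "\<And>m n. m \<in> M \<Longrightarrow> n \<in> M \<Longrightarrow> mdvd m n \<Longrightarrow> m = n"
  shows "minimal_gen_set (poly_ring V :: ('v, 'k::field) mpoly ring)
    (Idl\<^bsub>poly_ring V\<^esub> (monom ` M)) (monom ` M)"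
  unfolding minimal_gen_set_def
proof (intro conjI refl allI impI notI)
  show "monom ` M \<subseteq> carrier (poly_ring V :: ('v, 'k) mpoly ring)"
    using M by (rule monoms_subset_carrier)
  fix T :: "('v, 'k) mpoly set"
  assume T: "T \<subset> monom ` M" "Idl\<^bsub>poly_ring V\<^esub> T = Idl\<^bsub>poly_ring V\<^esub> (monom ` M)"
  define N where "N = {m \<in> M. (monom m :: ('v, 'k) mpoly) \<in> T}"
  have N: "T = monom ` N" using T by (auto simp: N_def)
  obtain m where "m \<in> M" "(monom m :: ('v, 'k) mpoly) \<notin> T" using T(1) by blast
  then have m: "m \<in> M" "m \<notin> N" by (simp_all add: N_def)
  have "(monom m :: ('v, 'k) mpoly) \<in> Idl\<^bsub>poly_ring V\<^esub> (monom ` M)"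
    using m M by (subst monom_in_Idl_iff) (auto intro: mdvd_refl)
  then have "(monom m :: ('v, 'k) mpoly) \<in> Idl\<^bsub>poly_ring V\<^esub> (monom ` N)"
    using T(2) N by simp
  then obtain n where "n \<in> N" "mdvd n m"
    using M by (subst (asm) monom_in_Idl_iff) (auto simp: N_def)
  then show False using anti[of n m] m by (auto simp: N_def)
qed

text \<open>Each \<open>m\<close> in the first set is divisible by some \<open>n\<close> in the second, which in turn is divisible by
  some \<open>m'\<close> in the first. Minimality forces \<open>m' = m\<close>, hence \<open>n = m\<close>.\<close>

lemma minimal_monomial_gens_unique:
  fixes I :: "('v, 'k::field) mpoly set"
  assumes M: "minimal_gen_set (poly_ring V) I (monom ` M)"
    and N: "minimal_gen_set (poly_ring V) I (monom ` N)"
  shows "M = N"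
proof -
  have "A \<subseteq> B" if A: "minimal_gen_set (poly_ring V) I (monom ` A)"
    and B: "minimal_gen_set (poly_ring V) I (monom ` B)" for A B
  proof
    fix m assume m: "m \<in> A"
    have "monom ` A \<subseteq> carrier (poly_ring V :: ('v, 'k) mpoly ring)"
      "monom ` B \<subseteq> carrier (poly_ring V :: ('v, 'k) mpoly ring)"
      by (fact minimal_gen_setD(1)[OF A] minimal_gen_setD(1)[OF B])+
    then have kA: "\<forall>m\<in>A. keys m \<subseteq> V" and kB: "\<forall>m\<in>B. keys m \<subseteq> V"
      by (simp_all add: image_subset_iff)
    have IA: "Idl\<^bsub>poly_ring V\<^esub> (monom ` A) = I" and IB: "Idl\<^bsub>poly_ring V\<^esub> (monom ` B) = I"
      by (fact minimal_gen_setD(2)[OF A] minimal_gen_setD(2)[OF B])+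
    have inA: "monom t \<in> I \<longleftrightarrow> keys t \<subseteq> V \<and> (\<exists>m \<in> A. mdvd m t)" for t
      using monom_in_Idl_iff[of A V t, where 'k='k, OF kA] unfolding IA by blast
    have inB: "monom t \<in> I \<longleftrightarrow> keys t \<subseteq> V \<and> (\<exists>m \<in> B. mdvd m t)" for t
      using monom_in_Idl_iff[of B V t, where 'k='k, OF kB] unfolding IB by blast
    have "monom m \<in> I" unfolding inA using kA m mdvd_refl by blast
    then obtain n where n: "n \<in> B" "mdvd n m" unfolding inB by blast
    have "monom n \<in> I" unfolding inB using kB n(1) mdvd_refl by blast
    then obtain m' where m': "m' \<in> A" "mdvd m' n" unfolding inA by blast
    have "m' = m"
    proof (rule ccontr)
      assume "m' \<noteq> m"
      have "mdvd m' m" using m' n mdvd_trans by blast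
      then have "Idl\<^bsub>poly_ring V\<^esub> (monom ` (A - {m})) =
          Idl\<^bsub>poly_ring V\<^esub> (monom ` A :: ('v, 'k) mpoly set)"
      proof -
        have "(\<exists>a \<in> A - {m}. mdvd a t) \<longleftrightarrow> (\<exists>a \<in> A. mdvd a t)" for t
          using \<open>m' \<noteq> m\<close> \<open>mdvd m' m\<close> m'(1) mdvd_trans by blast
        then show ?thesis
          using Idl_monom[of A V, where 'k='k, OF kA] Idl_monom[of "A - {m}" V, where 'k='k] kA by simp
      qed
      moreover have "monom ` (A - {m}) \<subset> (monom ` A :: ('v, 'k) mpoly set)"
        using m by (intro image_strict_mono inj_on_subset[OF inj_monom]) auto
      ultimately show False using minimal_gen_setD(3)[OF A] IA by blast
    qed
    then show "m \<in> B" using n m' mdvd_antisym by blast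
  qed
  then show ?thesis using M N by blast
qed

lemma sorted_wrt_asym_unique:
  assumes asym: "\<And>x y. lt x y \<Longrightarrow> \<not> lt y x"
    and "sorted_wrt lt xs" "sorted_wrt lt ys" "set xs = set ys"
  shows "xs = ys"
  using assms(2-)
proof (induction xs arbitrary: ys)
  case (Cons x xs)
  then obtain y ys' where ys: "ys = y # ys'" by (cases ys) auto
  have hd: "lt x z" if "z \<in> set xs" for z using that Cons.prems(1) by simp
  have hd': "lt y z" if "z \<in> set ys'" for z using that Cons.prems(2) ys by simp
  have eq: "insert x (set xs) = insert y (set ys')" using Cons.prems(3) ys by simp
  have "x = y"
  proof (rule ccontr)
    assume "x \<noteq> y"
    have "y \<in> insert x (set xs)" "x \<in> insert y (set ys')" by (simp add: eq, simp flip: eq)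
    then have "lt x y" "lt y x" using \<open>x \<noteq> y\<close> hd hd' by simp_all
    then show False using asym[of x y] by simp
  qed
  moreover have "x \<notin> set xs" "y \<notin> set ys'" using asym[of x x] asym[of y y] hd[of x] hd'[of y] by blast+
  then have "set xs = set ys'" using eq \<open>x = y\<close> by (metis insert_ident)
  ultimately show ?case using Cons ys by auto
qed auto

text \<open>Evaluates the definite description in \<^const>\<open>sorted_mono_gens\<close>: any increasing list of minimal
  monomial generators is the list, since the set of its entries is unique and an asymmetric relation
  sorts a set in at most one way.\<close>

lemma sorted_mono_gens_eqI:
  fixes I :: "('v, 'k::field) mpoly set"
  assumes "\<And>s t. lt s t \<Longrightarrow> \<not> lt t s" "sorted_wrt lt ts"
    "minimal_gen_set (poly_ring V) I (monom ` set ts)"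
  shows "sorted_mono_gens V lt I = map monom ts"
proof -
  have "(THE ts. sorted_wrt lt ts \<and> minimal_gen_set (poly_ring V) I (monom ` set ts)) = ts"
  proof (rule the_equality)
    fix us assume us: "sorted_wrt lt us \<and> minimal_gen_set (poly_ring V) I (monom ` set us)"
    then have "set us = set ts" using assms(3) by (intro minimal_monomial_gens_unique) auto
    then show "us = ts" using sorted_wrt_asym_unique[of lt us ts, OF assms(1)] assms(2) us by blast
  qed (use assms(2,3) in simp)
  then show ?thesis by (simp add: sorted_mono_gens_def)
qed

text \<open>The multipliers of \<open>f\<close> into \<open>I\<close> carry every multiple of \<open>f\<close> into \<open>I\<close>, because for fixed \<open>g\<close> the
  elements \<open>h\<close> with \<open>g * h \<in> I\<close> form an ideal.\<close>

lemma ideal_quotient_principal: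
  fixes f :: "('v, 'k::field) mpoly"
  assumes "ideal I (poly_ring V)" "f \<in> carrier (poly_ring V)"
  shows "ideal_quotient (poly_ring V) I (Idl\<^bsub>poly_ring V\<^esub> {f}) =
    {g \<in> carrier (poly_ring V). g * f \<in> I}"
proof -
  interpret R: cring "poly_ring V :: ('v, 'k) mpoly ring" by (rule poly_ring_cring)
  interpret ideal I "poly_ring V" by fact
  note [simp del] = poly_ring_simps(1)
  have "Idl\<^bsub>poly_ring V\<^esub> {f} \<subseteq> {h \<in> carrier (poly_ring V). g * h \<in> I}"
    if g: "g \<in> carrier (poly_ring V)" "g * f \<in> I" for g
  proof (rule R.genideal_minimal)
    show "ideal {h \<in> carrier (poly_ring V). g * h \<in> I} (poly_ring V)"
    proof (rule poly_ring_idealI)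
      fix h k :: "('v, 'k) mpoly"
      assume "h \<in> {h \<in> carrier (poly_ring V). g * h \<in> I}" "k \<in> carrier (poly_ring V)"
      then show "k * h \<in> {h \<in> carrier (poly_ring V). g * h \<in> I}"
        using R.m_closed[of k h] I_l_closed[of "g * h" k] by (simp add: mult.left_commute)
    next
      fix h k :: "('v, 'k) mpoly"
      assume "h \<in> {h \<in> carrier (poly_ring V). g * h \<in> I}"
        "k \<in> {h \<in> carrier (poly_ring V). g * h \<in> I}"
      then show "h + k \<in> {h \<in> carrier (poly_ring V). g * h \<in> I}"
        using R.a_closed[of h k] a_closed[of "g * h" "g * k"] by (simp add: distrib_left)
    qed (use R.zero_closed zero_closed in auto)
  qed (use g assms in auto)
  then show ?thesis
    using R.genideal_self'[OF assms(2)] by (auto simp: ideal_quotient_def)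
qed

lemma Idl_Var:
  assumes "U \<subseteq> V"
  shows "Idl\<^bsub>poly_ring V\<^esub> (Var ` U :: ('v, 'k::field) mpoly set) =
    {p \<in> carrier (poly_ring V). \<forall>t \<in> keys p. \<exists>v \<in> U. v \<in> keys t}"
proof -
  have Var: "Var ` U = (monom ` ((\<lambda>v. single v 1) ` U) :: ('v, 'k) mpoly set)"
    by (simp add: image_image Var_def)
  have "\<forall>m \<in> (\<lambda>v. single v (1::nat)) ` U. keys m \<subseteq> V" using assms by auto
  from Idl_monom[OF this] show ?thesis
    unfolding Var by (simp add: mdvd_single_iff del: One_nat_def poly_ring_simps(1))
qed

text \<open>Multiplication by a monomial shifts all exponents, so the quotient of a monomial ideal by a
  monomial is again described term by term. The hypothesis on \<open>t\<close> is the purely combinatorial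
  condition under which the quotient is generated by variables.\<close>

lemma monomial_quotient_eq_variables:
  assumes M: "\<forall>m\<in>M. keys m \<subseteq> V" and u: "keys u \<subseteq> V" and U: "U \<subseteq> V"
    and iff: "\<And>t. (\<exists>m \<in> M. mdvd m (t + u)) \<longleftrightarrow> (\<exists>v \<in> U. v \<in> keys t)"
  shows "ideal_quotient (poly_ring V) (Idl\<^bsub>poly_ring V\<^esub> (monom ` M))
      (Idl\<^bsub>poly_ring V\<^esub> {monom u}) = Idl\<^bsub>poly_ring V\<^esub> (Var ` U :: ('v, 'k::field) mpoly set)"
proof -
  interpret R: cring "poly_ring V :: ('v, 'k) mpoly ring" by (rule poly_ring_cring)
  have mu: "(monom u :: ('v, 'k) mpoly) \<in> carrier (poly_ring V)" using u by simp
  note Idl_Var[OF U, where 'k='k]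
  moreover have "ideal (Idl\<^bsub>poly_ring V\<^esub> (monom ` M)) (poly_ring V :: ('v, 'k) mpoly ring)"
    by (rule R.genideal_ideal[OF monoms_subset_carrier[OF M]])
  moreover have "g * monom u \<in> Idl\<^bsub>poly_ring V\<^esub> (monom ` M) \<longleftrightarrow>
      (\<forall>t \<in> keys g. \<exists>v \<in> U. v \<in> keys t)"
    if "g \<in> carrier (poly_ring V)" for g :: "('v, 'k) mpoly"
    using R.m_closed[OF that mu]
    by (subst Idl_monom[OF M]) (auto simp: keys_mult_monom simp flip: iff)
  ultimately show ?thesis
    by (subst ideal_quotient_principal) (use u in auto)
qed

section \<open>Ideals generated by variables\<close>

text \<open>Only the variables in \<open>U\<close> are kept. The values stay inside the polynomials, which are
  a vector space over the coefficient field.\<close>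

definition linear_part :: "'v set \<Rightarrow> ('v, 'k::field) mpoly \<Rightarrow> ('v, 'k) mpoly" where
  "linear_part U p = (\<Sum>v\<in>U. Const (lookup p (single v 1)) * Var v)"

lemma lookup_mult_zero: "lookup (p * q) 0 = lookup p 0 * lookup (q :: ('v, 'k::field) mpoly) 0"
proof (induction p rule: mpoly_induct)
  case (add t c p)
  have "mdvd t 0 \<longleftrightarrow> t = 0" by (auto simp: mdvd_def poly_mapping_eq_iff fun_eq_iff)
  then show ?case
    using add by (simp add: distrib_right lookup_add lookup_single_mult lookup_single when_def)
qed simp

lemma lookup_mult_variable:
  fixes p q :: "('v, 'k::field) mpoly"
  shows "lookup (p * q) (single v 1) =
    lookup p 0 * lookup q (single v 1) + lookup p (single v 1) * lookup q 0"
proof (induction p rule: mpoly_induct)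
  case (add t c p)
  have "mdvd t (single v 1) \<longleftrightarrow> t = 0 \<or> t = single v 1"
  proof
    assume t: "mdvd t (single v 1)"
    have le: "lookup t w \<le> (if v = w then 1 else 0)" for w
    proof -
      have "lookup t w \<le> lookup (single v 1) w" using t unfolding mdvd_def by blast
      then show ?thesis by (simp add: lookup_single when_def split: if_splits)
    qed
    have "t = single v (lookup t v)"
    proof (rule poly_mapping_eqI)
      fix w show "lookup t w = lookup (single v (lookup t v)) w"
        using le[of w] by (simp add: lookup_single when_def split: if_splits)
    qed
    moreover have "lookup t v = 0 \<or> lookup t v = 1"
      using le[of v] by auto
    ultimately show "t = 0 \<or> t = single v 1" by (metis single_zero)
  qed (auto simp: mdvd_def)
  moreover have "single v (1::nat) \<noteq> 0" by (auto dest: arg_cong[where f = keys])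
  ultimately show ?case
    using add by (auto simp: distrib_right distrib_left lookup_add lookup_single_mult lookup_single when_def)
qed simp

lemma Const_zero: "Const 0 = (0 :: ('v, 'k::field) mpoly)"
  by (simp add: Const_def)

lemma Const_add: "Const (a + b) = (Const a + Const b :: ('v, 'k::field) mpoly)"
  by (simp add: Const_def single_add)

lemma Const_mult: "Const (a * b) = (Const a * Const b :: ('v, 'k::field) mpoly)"
  by (simp add: Const_def mult_single)

text \<open>The product rule for the linear part; if \<open>q\<close> has no constant term, the linear part of a multiple
  of \<open>q\<close> is a scalar multiple of the linear part of \<open>q\<close>. This turns ideal generators into spanning
  vectors.\<close>

lemma linear_part_mult:
  "linear_part U (p * q) = Const (lookup p 0) * linear_part U q + Const (lookup q 0) * linear_part U p"
  unfolding linear_part_def lookup_mult_variable sum_distrib_left sum.distrib[symmetric]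
  by (rule sum.cong) (simp_all add: Const_add Const_mult algebra_simps del: One_nat_def)

lemma vector_space_mpoly: "vector_space (\<lambda>c (p :: ('v, 'k::field) mpoly). Const c * p)"
  by (rule vector_space.intro)
    (simp_all add: Const_add Const_mult distrib_left distrib_right mult.assoc, simp add: Const_def)

text \<open>A generating set \<open>S\<close> has no constant terms, so the linear parts of all elements of the ideal lie in
  the span of the linear parts of \<open>S\<close>. That span contains the independent vectors \<open>Var v\<close> for
  \<open>v \<in> U\<close>, whence \<open>card U \<le> card S\<close>.\<close>

lemma min_num_gens_variables:
  fixes U V :: "'v set"
  assumes U: "finite U" "U \<subseteq> V"
  shows "min_num_gens (poly_ring V) (Idl\<^bsub>poly_ring V\<^esub> (Var ` U :: ('v, 'k::field) mpoly set)) = card U"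
  unfolding min_num_gens_def
proof (rule Least_equality)
  interpret R: cring "poly_ring V :: ('v, 'k) mpoly ring" by (rule poly_ring_cring)
  have carr: "Var ` U \<subseteq> carrier (poly_ring V :: ('v, 'k) mpoly ring)"
    unfolding image_subset_iff using U(2) by (intro ballI Var_in_poly_ring) (rule subsetD)
  have sinj: "single v (1::nat) = single w 1 \<longleftrightarrow> v = w" for v w :: 'v
    by (auto dest: arg_cong[where f = keys])
  have inj: "inj_on (Var :: 'v \<Rightarrow> ('v, 'k) mpoly) U"
    using inj_monom[where 'v='v and 'k='k] sinj by (auto simp: inj_on_def Var_def inj_def)
  then show "\<exists>S\<subseteq>carrier (poly_ring V). finite S \<and> card S = card U \<and>
      Idl\<^bsub>poly_ring V\<^esub> S = Idl\<^bsub>poly_ring V\<^esub> (Var ` U :: ('v, 'k) mpoly set)"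
    using U carr by (intro exI[of _ "Var ` U"]) (auto simp: card_image)
  fix n
  assume "\<exists>S\<subseteq>carrier (poly_ring V). finite S \<and> card S = n \<and>
      Idl\<^bsub>poly_ring V\<^esub> S = Idl\<^bsub>poly_ring V\<^esub> (Var ` U :: ('v, 'k) mpoly set)"
  then obtain S :: "('v, 'k) mpoly set" where S: "S \<subseteq> carrier (poly_ring V)" "finite S" "card S = n"
      "Idl\<^bsub>poly_ring V\<^esub> S = Idl\<^bsub>poly_ring V\<^esub> (Var ` U)"
    by blast
  interpret vs: vector_space "\<lambda>c (p :: ('v, 'k) mpoly). Const c * p" by (rule vector_space_mpoly)
  have lookup_Var: "lookup (Var v :: ('v, 'k) mpoly) (single w 1) = (if v = w then 1 else 0)" for v w
    using sinj by (simp add: Var_def monom_def lookup_single when_def del: One_nat_def)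
  have const_Var: "lookup (Var v :: ('v, 'k) mpoly) 0 = 0" for v
    by (auto simp: Var_def monom_def lookup_single when_def dest: arg_cong[where f = keys])
  have lin_Var: "linear_part U (Var v) = (Var v :: ('v, 'k) mpoly)" if "v \<in> U" for v
  proof -
    have "linear_part U (Var v) = (\<Sum>w\<in>U. if v = w then Var w else (0 :: ('v, 'k) mpoly))"
      unfolding linear_part_def lookup_Var by (intro sum.cong) (auto simp: Const_def)
    then show ?thesis using that U by simp
  qed
  have lin_add: "linear_part U (p + q) = linear_part U p + linear_part U q" for p q :: "('v, 'k) mpoly"
    by (simp add: linear_part_def lookup_add Const_def single_add distrib_right sum.distrib)
  \<comment> \<open>An ideal containing \<open>S\<close>, hence containing every \<open>Var v\<close> with \<open>v \<in> U\<close>.\<close>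
  define J where "J = {f \<in> carrier (poly_ring V). lookup f 0 = 0 \<and> linear_part U f \<in> vs.span (linear_part U ` S)}"
  have "ideal J (poly_ring V)"
  proof (rule poly_ring_idealI)
    have "linear_part U 0 = (0 :: ('v, 'k) mpoly)" by (simp add: linear_part_def Const_zero)
    then show "0 \<in> J" by (simp add: J_def vs.span_zero)
    show "f + g \<in> J" if "f \<in> J" "g \<in> J" for f g
      using that R.a_closed[of f g] vs.span_add by (auto simp: J_def lookup_add lin_add simp del: poly_ring_simps(1))
    show "g * f \<in> J" if "f \<in> J" "g \<in> carrier (poly_ring V)" for f g
      using that R.m_closed[of g f] vs.span_scale
      by (auto simp: J_def lookup_mult_zero linear_part_mult Const_zero simp del: poly_ring_simps(1))
  qed (auto simp: J_def)
  moreover have "S \<subseteq> J"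
  proof
    fix s assume s: "s \<in> S"
    then have "s \<in> Idl\<^bsub>poly_ring V\<^esub> (Var ` U)" using S R.genideal_self[of S] by blast
    then have "\<forall>t \<in> keys s. \<exists>v \<in> U. v \<in> keys t" unfolding Idl_Var[OF U(2)] by simp
    then have "0 \<notin> keys s" by auto
    then have "lookup s 0 = 0" by (simp add: in_keys_iff)
    then show "s \<in> J" using s S(1) by (auto simp: J_def intro: vs.span_base simp del: poly_ring_simps(1))
  qed
  ultimately have "Idl\<^bsub>poly_ring V\<^esub> (Var ` U) \<subseteq> J"
    using R.genideal_minimal[of J S] S(4) by simp
  then have "Var ` U \<subseteq> J" using R.genideal_self[OF carr] by blast
  then have sp: "Var ` U \<subseteq> vs.span (linear_part U ` S)"
  proof clarify
    fix v assume "v \<in> U"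
    then have "Var v \<in> J" using \<open>Var ` U \<subseteq> J\<close> by blast
    then show "Var v \<in> vs.span (linear_part U ` S)" using lin_Var[OF \<open>v \<in> U\<close>] by (simp add: J_def)
  qed
  have "vs.independent (Var ` U)"
    unfolding vs.dependent_def
  proof clarify
    fix v assume v: "v \<in> U" and dep: "Var v \<in> vs.span (Var ` U - {Var v :: ('v, 'k) mpoly})"
    \<comment> \<open>The coefficient of \<open>v\<close> vanishes on the span of the other variables.\<close>
    have "vs.span (Var ` U - {Var v}) \<subseteq> {p. lookup p (single v 1) = 0}"
    proof (rule vs.span_minimal)
      show "vs.subspace {p. lookup p (single v 1) = 0}"
      proof (rule vs.subspaceI)
        show "Const c * x \<in> {p. lookup p (single v 1) = 0}" if "x \<in> {p. lookup p (single v 1) = 0}" for c x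
          using that lookup_single_mult[of 0 c x "single v 1"] by (simp add: Const_def mdvd_def)
      qed (auto simp: lookup_add)
    qed (use lookup_Var in auto)
    then show False using dep lookup_Var[of v v] by auto
  qed
  then have "card (Var ` U :: ('v, 'k) mpoly set) \<le> card (linear_part U ` S)"
    using vs.independent_span_bound[of "linear_part U ` S" "Var ` U"] S(2) sp by simp
  also have "\<dots> \<le> n" using S card_image_le by blast
  finally show "card U \<le> n" by (simp add: card_image[OF inj])
qed

section \<open>Square-free monomials\<close>

definition sqfree :: "'v set \<Rightarrow> 'v mono" where
  "sqfree A = (\<Sum>v\<in>A. single v 1)"

lemma lookup_sqfree: "finite A \<Longrightarrow> lookup (sqfree A) v = (if v \<in> A then 1 else 0)"
  by (simp add: sqfree_def lookup_sum lookup_single when_def)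

lemma keys_sqfree: "finite A \<Longrightarrow> keys (sqfree A) = A"
  by (auto simp: in_keys_iff lookup_sqfree split: if_splits)

lemma mdeg_sqfree: "mdeg (sqfree A) = card A"
  by (simp add: sqfree_def mdeg_sum)

lemma mdvd_sqfree_iff: "finite A \<Longrightarrow> mdvd (sqfree A) t \<longleftrightarrow> A \<subseteq> keys t"
  by (auto simp: mdvd_def lookup_sqfree in_keys_iff Suc_le_eq split: if_splits)

lemma mdvd_sqfree_add_iff:
  "finite A \<Longrightarrow> finite B \<Longrightarrow> mdvd (sqfree A) (t + sqfree B) \<longleftrightarrow> A - B \<subseteq> keys t"
  by (auto simp: mdvd_sqfree_iff in_keys_iff lookup_add lookup_sqfree split: if_splits)

section \<open>Initial ideals of toric ideals of graphs\<close>

text \<open>The exponent vector of the image of a monomial under the toric map. The value at a vertex is the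
  total exponent of the edges at that vertex.\<close>

definition mono_image :: "'v set mono \<Rightarrow> 'v mono" where
  "mono_image t = (\<Sum>e\<in>keys t. \<Sum>v\<in>e. single v (lookup t e))"

lemma mono_image_eq_sum:
  assumes "finite K" "keys t \<subseteq> K"
  shows "mono_image t = (\<Sum>e\<in>K. \<Sum>v\<in>e. single v (lookup t e))"
  unfolding mono_image_def using assms
  by (intro sum.mono_neutral_left) (auto simp: in_keys_iff)

lemma mono_image_sqfree: "finite A \<Longrightarrow> mono_image (sqfree A) = (\<Sum>e\<in>A. \<Sum>v\<in>e. single v 1)"
  by (simp add: mono_image_def keys_sqfree lookup_sqfree)

lemma lookup_mono_image:
  assumes "finite K" "keys t \<subseteq> K" "\<forall>e\<in>K. finite e"
  shows "lookup (mono_image t) v = (\<Sum>e\<in>K. if v \<in> e then lookup t e else 0)"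
  unfolding mono_image_eq_sum[OF assms(1,2)] lookup_sum
  using assms(3) by (intro sum.cong) (simp_all add: lookup_single when_def)

lemma mdeg_mono_image:
  assumes "\<forall>e\<in>keys t. card e = 2"
  shows "mdeg (mono_image t) = 2 * mdeg t"
  using assms by (simp add: mono_image_def mdeg_sum mdeg_def[of t] sum_distrib_left)

lemma Var_power: "Var v ^ n = (monom (single v n) :: ('v, 'k::field) mpoly)"
  by (induction n) (simp_all add: monom_zero Var_def flip: monom_add single_add)

lemma toric_map_eq: "toric_map p = (\<Sum>t\<in>keys p. single (mono_image t) (lookup p t))"
proof -
  have "(\<Prod>v\<in>e. Var v) ^ n = (monom (\<Sum>v\<in>e. single v n) :: ('a, 'b) mpoly)" for e :: "'a set" and n
    by (simp add: prod_power_distrib monom_sum Var_power)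
  then have "toric_map p = (\<Sum>t\<in>keys p. Const (lookup p t) * monom (mono_image t))"
    by (simp add: toric_map_def mono_image_def monom_sum)
  then show ?thesis by (simp add: Const_def monom_def mult_single)
qed

lemma toric_map_monom: "toric_map (monom t) = (monom (mono_image t) :: ('v, 'k::field) mpoly)"
  by (simp add: toric_map_eq) (simp add: monom_def)

text \<open>In the image of \<open>p\<close> the coefficient of \<open>mono_image t\<close> is the sum of the coefficients of \<open>p\<close> over the
  fibre of \<open>t\<close>; it can vanish only if the fibre meets \<^term>\<open>keys p\<close> in a second monomial.\<close>

lemma toric_map_eq_0_fibre:
  assumes "toric_map p = 0" "t \<in> keys p"
  obtains s where "s \<in> keys p" "s \<noteq> t" "mono_image s = mono_image t"
proof (rule ccontr)
  assume "\<not> thesis"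
  then have *: "mono_image s \<noteq> mono_image t" if "s \<in> keys p" "s \<noteq> t" for s
    using that \<open>\<And>s. s \<in> keys p \<Longrightarrow> s \<noteq> t \<Longrightarrow> mono_image s = mono_image t \<Longrightarrow> thesis\<close> by blast
  have "lookup (toric_map p) (mono_image t) =
      (\<Sum>s\<in>keys p. if s = t then lookup p t else 0)"
    unfolding toric_map_eq lookup_sum
    by (intro sum.cong) (auto simp: lookup_single when_def dest: *)
  then show False using assms by (simp add: in_keys_iff)
qed

lemma toric_binomial:
  assumes "mono_image s = mono_image t" "keys s \<subseteq> E" "keys t \<subseteq> E"
  shows "monom t - monom s \<in> (toric_ideal V E :: ('v set, 'k::field) mpoly set)"
proof -
  have "keys (monom t - monom s :: ('v set, 'k) mpoly) \<subseteq> {t, s}"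
    by (auto simp: in_keys_iff lookup_minus monom_def lookup_single when_def split: if_splits)
  moreover have "toric_map (monom t - monom s :: ('v set, 'k) mpoly) = 0"
    using toric_map_add[of "monom t - monom s :: ('v set, 'k) mpoly" "monom s"] assms(1)
    by (simp add: toric_map_monom)
  ultimately show ?thesis
    using assms(2,3) by (auto simp: toric_ideal_def a_kernel_def')
qed

text \<open>A monomial leads an element of the toric ideal if and only if its fibre under
  \<^const>\<open>mono_image\<close> contains a smaller one: binomials give one direction, and a leading monomial needs a smaller partner in its
  fibre for the other. So it is enough that every member of \<open>M\<close> has a smaller partner and
  that every monomial with a smaller partner is divisible by a member of \<open>M\<close>.\<close>

lemma initial_ideal_toric_eq:
  fixes M :: "'v set mono set"
  assumes asym: "\<And>s t. lt s t \<Longrightarrow> \<not> lt t s"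
    and M: "\<forall>m\<in>M. keys m \<subseteq> E"
    and nonmin: "\<And>m. m \<in> M \<Longrightarrow> \<exists>s. keys s \<subseteq> E \<and> mono_image s = mono_image m \<and> lt s m"
    and div: "\<And>s t. keys s \<subseteq> E \<Longrightarrow> keys t \<subseteq> E \<Longrightarrow> mono_image s = mono_image t \<Longrightarrow> lt s t \<Longrightarrow>
      \<exists>m\<in>M. mdvd m t"
  shows "initial_ideal E lt (toric_ideal V E) =
    Idl\<^bsub>poly_ring E\<^esub> (monom ` M :: ('v set, 'k::field) mpoly set)"
proof -
  define T where "T = {t. \<exists>p \<in> toric_ideal V E :: ('v set, 'k) mpoly set. is_leading_mono lt p t}"
  have T: "keys t \<subseteq> E \<and> (\<exists>m\<in>M. mdvd m t)" if t: "t \<in> T" for t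
  proof -
    obtain p :: "('v set, 'k) mpoly" where p: "p \<in> carrier (poly_ring E)" "toric_map p = 0"
      and lead: "t \<in> keys p" "\<And>s. s \<in> keys p \<Longrightarrow> s \<noteq> t \<Longrightarrow> lt s t"
      using t by (auto simp: T_def toric_ideal_def a_kernel_def' is_leading_mono_def)
    obtain s where s: "s \<in> keys p" "s \<noteq> t" "mono_image s = mono_image t"
      using toric_map_eq_0_fibre[OF p(2) lead(1)] by blast
    have "keys s \<subseteq> E" "keys t \<subseteq> E" using p(1) s lead by auto
    then show ?thesis using div[of s t] s lead(2)[of s] by simp
  qed
  have "M \<subseteq> T"
  proof
    fix m assume m: "m \<in> M"
    obtain s where s: "keys s \<subseteq> E" "mono_image s = mono_image m" "lt s m"
      using nonmin[OF m] by blast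
    have "s \<noteq> m" using s(3) asym[of s m] by auto
    have "is_leading_mono lt (monom m - monom s :: ('v set, 'k) mpoly) m"
      unfolding is_leading_mono_def
    proof (intro conjI ballI impI)
      show "m \<in> keys (monom m - monom s :: ('v set, 'k) mpoly)"
        using \<open>s \<noteq> m\<close> by (simp add: in_keys_iff lookup_minus monom_def lookup_single when_def)
      fix u assume "u \<in> keys (monom m - monom s :: ('v set, 'k) mpoly)" "u \<noteq> m"
      then have "u = s"
        by (auto simp: in_keys_iff lookup_minus monom_def lookup_single when_def split: if_splits)
      then show "lt u m" using s by simp
    qed
    moreover have "monom m - monom s \<in> (toric_ideal V E :: ('v set, 'k) mpoly set)"
      using s M m by (intro toric_binomial) auto
    ultimately show "m \<in> T" unfolding T_def by blast
  qed
  have "initial_ideal E lt (toric_ideal V E) = Idl\<^bsub>poly_ring E\<^esub> (monom ` T :: ('v set, 'k) mpoly set)"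
    by (simp add: initial_ideal_def T_def setcompr_eq_image)
  also have "\<dots> = Idl\<^bsub>poly_ring E\<^esub> (monom ` M)"
  proof -
    have "(\<exists>m\<in>T. mdvd m t) \<longleftrightarrow> (\<exists>m\<in>M. mdvd m t)" for t
      using T \<open>M \<subseteq> T\<close> mdvd_trans by blast
    then show ?thesis using T M by (subst (1 2) Idl_monom) auto
  qed
  finally show ?thesis .
qed

section \<open>The graded reverse lexicographic order\<close>

lemma grevlex_less_asym: "grevlex_less vs s t \<Longrightarrow> \<not> grevlex_less vs t s"
  unfolding grevlex_less_def by (metis less_irrefl less_not_sym linorder_neqE_nat)

lemma grevlex_lessI:
  assumes "mdeg s = mdeg t" "vs = xs @ v # ys" "lookup s v > lookup t v"
    "\<And>w. w \<in> set ys \<Longrightarrow> lookup s w = lookup t w"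
  shows "grevlex_less vs s t"
proof -
  have "\<forall>j. length xs < j \<and> j < length vs \<longrightarrow> lookup s (vs ! j) = lookup t (vs ! j)"
  proof (intro allI impI)
    fix j assume j: "length xs < j \<and> j < length vs"
    then have "vs ! j \<in> set ys"
      by (auto simp: assms(2) nth_append nth_Cons')
    then show "lookup s (vs ! j) = lookup t (vs ! j)" by (rule assms(4))
  qed
  moreover have "length xs < length vs" "vs ! length xs = v" by (simp_all add: assms(2))
  ultimately show ?thesis unfolding grevlex_less_def using assms(1,3) by metis
qed

lemma upt_split: "1 \<le> i \<Longrightarrow> i \<le> d \<Longrightarrow> [1..<Suc d] = [1..<i] @ i # [Suc i..<Suc d]"
  using upt_add_eq_append[of 1 i "Suc d - i"] upt_conv_Cons[of i "Suc d"] by simp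

lemma G_less_asym: "G_less r d s t \<Longrightarrow> \<not> G_less r d t s"
  unfolding G_less_def by (rule grevlex_less_asym)

lemma G_less_by_b:
  assumes "mdeg s = mdeg t" "i \<in> {1..d}" "lookup s (edge_b i) > lookup t (edge_b i)"
    "\<And>k. k \<in> {i<..d} \<Longrightarrow> lookup s (edge_b k) = lookup t (edge_b k)"
  shows "G_less r d s t"
proof -
  have split: "[1..<Suc d] = [1..<i] @ i # [Suc i..<Suc d]" using assms(2) by (intro upt_split) auto
  show ?thesis
    unfolding G_less_def
    by (rule grevlex_lessI[where v = "edge_b i" and ys = "map edge_b [Suc i..<Suc d]"
        and xs = "map edge_a [1..<Suc d] @ map (edge_e r) [1..<Suc (2 * r - 2)] @ map edge_b [1..<i]"])
      (use assms split in \<open>auto simp del: upt_Suc\<close>)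
qed

lemma G_less_by_a:
  assumes "mdeg s = mdeg t" "i \<in> {1..d}" "lookup s (edge_a i) > lookup t (edge_a i)"
    "\<And>k. k \<in> {i<..d} \<Longrightarrow> lookup s (edge_a k) = lookup t (edge_a k)"
    "\<And>k. k \<in> {1..2*r-2} \<Longrightarrow> lookup s (edge_e r k) = lookup t (edge_e r k)"
    "\<And>k. k \<in> {1..d} \<Longrightarrow> lookup s (edge_b k) = lookup t (edge_b k)"
  shows "G_less r d s t"
proof -
  have split: "[1..<Suc d] = [1..<i] @ i # [Suc i..<Suc d]" using assms(2) by (intro upt_split) auto
  then have split_a: "map edge_a [1..<Suc d] = map edge_a [1..<i] @ edge_a i # map edge_a [Suc i..<Suc d]"
    by (simp del: upt_Suc)
  show ?thesis
    unfolding G_less_def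
    by (rule grevlex_lessI[where v = "edge_a i" and xs = "map edge_a [1..<i]"
        and ys = "map edge_a [Suc i..<Suc d] @ map (edge_e r) [1..<Suc (2 * r - 2)] @ map edge_b [1..<Suc d]"])
      (use assms split_a in \<open>auto simp del: upt_Suc\<close>)
qed

text \<open>For equal degrees the comparison is decided by the last edge at which the exponents differ. The
  only distinction that matters later is whether that edge is some \<open>b\<^sub>i\<close> or comes before all of them.\<close>

lemma G_less_same_degree_cases:
  assumes "G_less r d s t" "mdeg s = mdeg t"
  obtains (b) i where "i \<in> {1..d}" "lookup s (edge_b i) > lookup t (edge_b i)"
      "\<And>k. k \<in> {i<..d} \<Longrightarrow> lookup s (edge_b k) = lookup t (edge_b k)"
  | (a_e) e where "e \<in> G_edges r d" "lookup s e > lookup t e"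
      "\<And>k. k \<in> {1..d} \<Longrightarrow> lookup s (edge_b k) = lookup t (edge_b k)"
proof -
  define xs where "xs = map edge_a [1..<Suc d] @ map (edge_e r) [1..<Suc (2 * r - 2)]"
  define vs where "vs = xs @ map edge_b [1..<Suc d]"
  have len: "length vs = length xs + d" by (simp add: vs_def)
  have nth_b: "vs ! (length xs + (k - 1)) = edge_b k" if "k \<in> {1..d}" for k
  proof -
    have "map edge_b [1..<Suc d] ! (k - 1) = edge_b k"
      using that by (subst nth_map) (auto simp del: upt_Suc)
    then show ?thesis unfolding vs_def nth_append_length_plus .
  qed
  have "G_less r d = grevlex_less vs" by (simp add: G_less_def vs_def xs_def)
  then obtain n where n: "n < length vs" "lookup s (vs ! n) > lookup t (vs ! n)"
      "\<And>j. n < j \<Longrightarrow> j < length vs \<Longrightarrow> lookup s (vs ! j) = lookup t (vs ! j)"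
    using assms by (auto simp: grevlex_less_def)
  \<comment> \<open>The list positions \<open>length xs, length xs + 1, \<dots>\<close> hold \<open>b\<^sub>1, b\<^sub>2, \<dots>\<close>.\<close>
  have later: "lookup s (edge_b k) = lookup t (edge_b k)"
    if "k \<in> {1..d}" "n < length xs + (k - 1)" for k
  proof -
    have "length xs + (k - 1) < length vs" using that(1) len by auto
    from n(3)[OF that(2) this] show ?thesis unfolding nth_b[OF that(1)] .
  qed
  show ?thesis
  proof (cases "n < length xs")
    case True
    have "vs ! n \<in> set xs" using True by (simp add: vs_def nth_append)
    then have "vs ! n \<in> G_edges r d" by (auto simp: xs_def G_edges_def less_Suc_eq_le)
    moreover have "lookup s (edge_b k) = lookup t (edge_b k)" if "k \<in> {1..d}" for k
      using later[OF that] True by simp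
    ultimately show ?thesis using n(2) a_e by blast
  next
    case False
    define i where "i = n - length xs + 1"
    have i: "i \<in> {1..d}" and n': "n = length xs + (i - 1)" using False n(1) len by (auto simp: i_def)
    moreover have "lookup s (edge_b k) = lookup t (edge_b k)" if "k \<in> {i<..d}" for k
      using later[of k] n' that i by auto
    moreover have "lookup s (edge_b i) > lookup t (edge_b i)"
      using n(2) unfolding n' nth_b[OF i] .
    ultimately show ?thesis by (intro b)
  qed
qed

section \<open>The edges of the graph\<close>

lemma edge_a_eq_iff: "edge_a i = edge_a k \<longleftrightarrow> i = k"
  and edge_b_eq_iff: "edge_b i = edge_b k \<longleftrightarrow> i = k"
  and edge_a_neq_b: "edge_a i \<noteq> edge_b k"
  and edge_a_neq_e: "edge_a i \<noteq> edge_e r l"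
  and edge_b_neq_e: "edge_b i \<noteq> edge_e r l"
  by (auto simp: edge_a_def edge_b_def edge_e_def doubleton_eq_iff)

lemma edge_e_eq_iff:
  assumes "r \<ge> 3" "k \<in> {1..2*r-2}" "l \<in> {1..2*r-2}"
  shows "edge_e r k = edge_e r l \<longleftrightarrow> k = l"
  using assms by (auto simp: edge_e_def doubleton_eq_iff)

lemma inj_on_edge_e:
  assumes "r \<ge> 3"
  shows "inj_on (\<lambda>k. edge_e r (2 * k)) {1..r-1}" "inj_on (\<lambda>k. edge_e r (2 * k - 1)) {1..r-1}"
proof -
  have "k = l" if "edge_e r (2 * k - 1) = edge_e r (2 * l - 1)" "k \<in> {1..r-1}" "l \<in> {1..r-1}" for k l
  proof -
    have "2 * k - 1 \<in> {1..2*r-2}" "2 * l - 1 \<in> {1..2*r-2}"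
      using that(2,3) unfolding atLeastAtMost_iff by linarith+
    then have "2 * k - 1 = 2 * l - 1" using edge_e_eq_iff[OF assms] that(1) by blast
    then show ?thesis using that by auto
  qed
  then show "inj_on (\<lambda>k. edge_e r (2 * k - 1)) {1..r-1}" by (rule inj_onI)
qed (use edge_e_eq_iff[OF assms] in \<open>auto simp: inj_on_def\<close>)

lemmas edge_neq = edge_a_eq_iff edge_b_eq_iff edge_a_neq_b edge_a_neq_b[symmetric]
  edge_a_neq_e edge_a_neq_e[symmetric] edge_b_neq_e edge_b_neq_e[symmetric]

lemma finite_edge: "finite (edge_a i)" "finite (edge_b i)" "finite (edge_e r l)"
  by (simp_all add: edge_a_def edge_b_def edge_e_def)

lemma finite_G_edges: "finite (G_edges r d)"
  by (simp add: G_edges_def)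

lemma sum_G_edges:
  assumes "r \<ge> 3"
  shows "sum f (G_edges r d) =
    (\<Sum>i=1..d. f (edge_a i)) + (\<Sum>i=1..d. f (edge_b i)) + (\<Sum>l=1..2*r-2. f (edge_e r l))"
proof -
  have "inj_on edge_a {1..d}" "inj_on edge_b {1..d}" "inj_on (edge_e r) {1..2*r-2}"
    using edge_e_eq_iff[OF assms] by (auto simp: inj_on_def edge_neq)
  then show ?thesis
    unfolding G_edges_def
    by (subst sum.union_disjoint; (subst sum.union_disjoint)?) (auto simp: edge_neq sum.reindex)
qed

text \<open>The degree conditions at the vertices other than \<open>x\<^sub>1\<close>; together they determine the fibre, as
  the graph is bipartite.\<close>

lemma lookup_mono_image_G:
  assumes r: "r \<ge> 3" and t: "keys t \<subseteq> G_edges r d"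
  shows "i \<in> {1..d} \<Longrightarrow> lookup (mono_image t) (Y i) = lookup t (edge_a i) + lookup t (edge_b i)"
    and "l \<in> {1..2*r-3} \<Longrightarrow>
      lookup (mono_image t) (Z l) = lookup t (edge_e r l) + lookup t (edge_e r (Suc l))"
    and "lookup (mono_image t) (X 2) = (\<Sum>i=1..d. lookup t (edge_b i)) + lookup t (edge_e r (2*r-2))"
proof -
  have fin: "\<forall>e\<in>G_edges r d. finite e" by (auto simp: G_edges_def finite_edge)
  note eq = lookup_mono_image[OF finite_G_edges t fin] sum_G_edges[OF r]
  have Y: "Y i \<in> edge_a k \<longleftrightarrow> k = i" "Y i \<in> edge_b k \<longleftrightarrow> k = i" "Y i \<notin> edge_e r l" for i k l
    by (auto simp: edge_a_def edge_b_def edge_e_def)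
  show "lookup (mono_image t) (Y i) = lookup t (edge_a i) + lookup t (edge_b i)" if "i \<in> {1..d}"
    using that by (simp add: eq Y)
  have "X 2 \<in> edge_e r l \<longleftrightarrow> l = 2*r-2" if "l \<in> {1..2*r-2}" for l
    using that r by (auto simp: edge_e_def)
  then have "(\<Sum>l=1..2*r-2. if X 2 \<in> edge_e r l then lookup t (edge_e r l) else 0) =
      (\<Sum>l=1..2*r-2. if l = 2*r-2 then lookup t (edge_e r l) else 0)"
    by (intro sum.cong) auto
  moreover have "X 2 \<notin> edge_a k" "X 2 \<in> edge_b k" for k by (auto simp: edge_a_def edge_b_def)
  moreover have "Suc 0 \<le> 2 * r - 2" using r by simp
  ultimately show "lookup (mono_image t) (X 2) = (\<Sum>i=1..d. lookup t (edge_b i)) + lookup t (edge_e r (2*r-2))"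
    by (simp add: eq)
  assume l: "l \<in> {1..2*r-3}"
  have "Z l \<in> edge_e r k \<longleftrightarrow> k = l \<or> k = Suc l" if "k \<in> {1..2*r-2}" for k
    using that l r by (auto simp: edge_e_def)
  then have "(\<Sum>k=1..2*r-2. if Z l \<in> edge_e r k then lookup t (edge_e r k) else 0) =
      (\<Sum>k\<in>{l, Suc l}. lookup t (edge_e r k))"
    using l r by (intro sum.mono_neutral_cong_right) auto
  moreover have "Z l \<notin> edge_a k" "Z l \<notin> edge_b k" for k by (auto simp: edge_a_def edge_b_def)
  ultimately show "lookup (mono_image t) (Z l) = lookup t (edge_e r l) + lookup t (edge_e r (Suc l))"
    by (simp add: eq)
qed

section \<open>The generators\<close>

text \<open>Writing \<open>c\<^sub>j = b\<^sub>j\<close> for \<open>j \<ge> 1\<close> and \<open>c\<^sub>0 = e\<^sub>2 e\<^sub>4 \<dots> e\<^sub>2\<^sub>r\<^sub>-\<^sub>2\<close> turns both families of generators into the single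
  family \<open>a\<^sub>i c\<^sub>j\<close> with \<open>0 \<le> j < i \<le> d\<close>. The edges of \<open>c\<^sub>j\<close> are collected here.\<close>

definition gen_tail :: "nat \<Rightarrow> nat \<Rightarrow> vertex set set" where
  "gen_tail r j = (if j = 0 then (\<lambda>k. edge_e r (2 * k)) ` {1..r-1} else {edge_b j})"

definition gen_edges :: "nat \<Rightarrow> nat \<times> nat \<Rightarrow> vertex set set" where
  "gen_edges r x = insert (edge_a (fst x)) (gen_tail r (snd x))"

definition gen_idx :: "nat \<Rightarrow> (nat \<times> nat) set" where
  "gen_idx d = {(i, j). j < i \<and> i \<le> d}"

definition listed_before :: "nat \<times> nat \<Rightarrow> nat \<times> nat \<Rightarrow> bool" where
  "listed_before x y \<longleftrightarrow> snd y < snd x \<or> snd x = snd y \<and> fst y < fst x"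

abbreviation gen :: "nat \<Rightarrow> nat \<times> nat \<Rightarrow> vertex set mono" where
  "gen r x \<equiv> sqfree (gen_edges r x)"

lemma finite_gen_edges: "finite (gen_edges r x)"
  by (simp add: gen_edges_def gen_tail_def)

lemma edge_a_in_gen_edges: "edge_a k \<in> gen_edges r (i, j) \<longleftrightarrow> k = i"
  by (auto simp: gen_edges_def gen_tail_def edge_neq)

lemma edge_b_in_gen_edges: "edge_b k \<in> gen_edges r (i, j) \<longleftrightarrow> j \<noteq> 0 \<and> k = j"
  by (auto simp: gen_edges_def gen_tail_def edge_neq)

lemma edge_e_in_gen_edges: "edge_e r l \<in> gen_edges r (i, j) \<longleftrightarrow> edge_e r l \<in> gen_tail r j"
  by (auto simp: gen_edges_def edge_neq)

lemma gen_tail_subset: "j \<in> {0..d} \<Longrightarrow> gen_tail r j \<subseteq> G_edges r d"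
  by (auto simp: gen_tail_def G_edges_def)

lemma gen_edges_subset: "x \<in> gen_idx d \<Longrightarrow> gen_edges r x \<subseteq> G_edges r d"
  using gen_tail_subset[of "snd x" d r] by (auto simp: gen_edges_def gen_idx_def G_edges_def)

lemma keys_gen: "x \<in> gen_idx d \<Longrightarrow> keys (gen r x) \<subseteq> G_edges r d"
  by (simp add: keys_sqfree finite_gen_edges gen_edges_subset)

lemma card_evens:
  assumes "r \<ge> 3" shows "card ((\<lambda>k. edge_e r (2 * k)) ` {1..r-1}) = r - 1"
  using card_image[OF inj_on_edge_e(1)[OF assms]] by simp

lemma mdeg_gen:
  assumes "r \<ge> 3" shows "mdeg (gen r (i, j)) = (if j = 0 then r else 2)"
proof -
  have "edge_a i \<notin> gen_tail r j" by (auto simp: gen_tail_def edge_neq)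
  then show ?thesis
    using assms card_evens[OF assms]
    by (simp add: mdeg_sqfree gen_edges_def gen_tail_def)
qed

text \<open>Let \<open>x = (i', j')\<close> and \<open>y = (i, j)\<close>. For \<open>j' = j\<close> the edge \<open>a\<^sub>i\<^sub>'\<close> decides, for \<open>j' > j \<ge> 1\<close> the edge \<open>b\<^sub>j\<^sub>'\<close>, and for \<open>j' > j = 0\<close> the degrees
  \<open>2 < r\<close> differ.\<close>

lemma gen_sorted:
  assumes r: "r \<ge> 3" and x: "x \<in> gen_idx d" and y: "y \<in> gen_idx d" and "listed_before x y"
  shows "G_less r d (gen r x) (gen r y)"
proof -
  obtain i j i' j' where xy: "x = (i', j')" "y = (i, j)" by (cases x; cases y) auto
  note lk = lookup_sqfree[OF finite_gen_edges] edge_a_in_gen_edges edge_b_in_gen_edges edge_e_in_gen_edges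
  consider "j' = j" "i < i'" | "j < j'" "j = 0" | "j < j'" "j \<noteq> 0"
    using assms(4) by (auto simp: listed_before_def xy)
  then show ?thesis
  proof cases
    case 1
    then show ?thesis
      using x unfolding xy
      by (intro G_less_by_a[where i = i']) (auto simp: gen_idx_def mdeg_gen[OF r] lk)
  next
    case 2
    then have "mdeg (gen r x) < mdeg (gen r y)" using r by (simp add: xy mdeg_gen)
    then show ?thesis by (simp add: G_less_def grevlex_less_def)
  next
    case 3
    then show ?thesis
      using x unfolding xy
      by (intro G_less_by_b[where i = j']) (auto simp: gen_idx_def mdeg_gen[OF r] lk)
  qed
qed

lemma gen_antichain:
  assumes r: "r \<ge> 3" and x: "x \<in> gen_idx d" and y: "y \<in> gen_idx d" and dvd: "mdvd (gen r x) (gen r y)"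
  shows "x = y"
proof -
  obtain i j i' j' where xy: "x = (i', j')" "y = (i, j)" by (cases x; cases y) auto
  have sub: "gen_edges r x \<subseteq> gen_edges r y"
    using dvd by (simp add: mdvd_sqfree_iff keys_sqfree finite_gen_edges)
  have "edge_a i' \<in> gen_edges r x" unfolding xy edge_a_in_gen_edges by simp
  then have "i' = i" using sub edge_a_in_gen_edges xy by blast
  moreover have "j' = j"
  proof (cases "j' = 0")
    case True
    \<comment> \<open>The edge \<open>e\<^sub>2\<close> occurs in \<open>c\<^sub>0\<close> and in no other tail.\<close>
    then have "edge_e r 2 \<in> gen_edges r x"
      using r by (auto simp: xy gen_edges_def gen_tail_def intro!: image_eqI[of _ _ 1])
    then have "edge_e r 2 \<in> gen_tail r j" using sub edge_e_in_gen_edges xy by blast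
    then show ?thesis using True by (auto simp: gen_tail_def edge_neq split: if_splits)
  next
    case False
    then have "edge_b j' \<in> gen_edges r x" unfolding xy edge_b_in_gen_edges by simp
    then show ?thesis using sub edge_b_in_gen_edges xy by blast
  qed
  ultimately show ?thesis by (simp add: xy)
qed

section \<open>The initial ideal\<close>

text \<open>The vertices of the long path from \<open>x\<^sub>1\<close> to \<open>x\<^sub>2\<close>, numbered so that \<open>e\<^sub>l\<close> joins the vertices \<open>l - 1\<close> and \<open>l\<close>.\<close>

definition path_vertex :: "nat \<Rightarrow> nat \<Rightarrow> vertex" where
  "path_vertex r l = (if l = 0 then X 1 else if l = 2 * r - 2 then X 2 else Z l)"

lemma edge_e_path_vertex:
  assumes "r \<ge> 3" "l \<in> {1..2*r-2}"
  shows "edge_e r l = {path_vertex r (l - 1), path_vertex r l}" "path_vertex r (l - 1) \<noteq> path_vertex r l"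
  using assms by (auto simp: edge_e_def path_vertex_def)

text \<open>Along a path of even length the even edges cover every vertex but the first, and the odd edges
  every vertex but the last.\<close>

lemma alternate_path_sums:
  fixes g :: "nat \<Rightarrow> 'a::comm_monoid_add"
  shows "g 0 + (\<Sum>k=1..n. g (2*k-1) + g (2*k)) = g (2*n) + (\<Sum>k=1..n. g (2*k-2) + g (2*k-1))"
proof (induction n)
  case (Suc n)
  let ?S = "\<Sum>k=1..n. g (2*k-1) + g (2*k)" and ?T = "\<Sum>k=1..n. g (2*k-2) + g (2*k-1)"
  have "g 0 + (?S + (g (2*n+1) + g (2*n+2))) = (g 0 + ?S) + (g (2*n+1) + g (2*n+2))"
    by (simp add: add.assoc)
  also have "\<dots> = g (2*n+2) + (?T + (g (2*n) + g (2*n+1)))"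
    unfolding Suc.IH by (simp add: ac_simps)
  finally show ?case by simp
qed simp

text \<open>The other monomial of the binomial of an even cycle: \<open>a\<^sub>j b\<^sub>i\<close> against \<open>a\<^sub>i b\<^sub>j\<close> on the 4-cycle through
  \<open>y\<^sub>i\<close> and \<open>y\<^sub>j\<close>, and \<open>b\<^sub>i e\<^sub>1 e\<^sub>3 \<dots> e\<^sub>2\<^sub>r\<^sub>-\<^sub>3\<close> against \<open>a\<^sub>i e\<^sub>2 e\<^sub>4 \<dots> e\<^sub>2\<^sub>r\<^sub>-\<^sub>2\<close> on the \<open>2r\<close>-cycle through \<open>y\<^sub>i\<close>.\<close>

definition partner_edges :: "nat \<Rightarrow> nat \<times> nat \<Rightarrow> vertex set set" where
  "partner_edges r x = insert (edge_b (fst x))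
     (if snd x = 0 then (\<lambda>k. edge_e r (2 * k - 1)) ` {1..r-1} else {edge_a (snd x)})"

lemma finite_partner_edges: "finite (partner_edges r x)"
  by (simp add: partner_edges_def)

lemma mono_image_partner:
  assumes r: "r \<ge> 3" and x: "x \<in> gen_idx d"
  shows "mono_image (sqfree (partner_edges r x)) = mono_image (gen r x)"
proof -
  obtain i j where xij: "x = (i, j)" by (cases x)
  define g where "g l = single (path_vertex r l) (1::nat)" for l
  define h where "h e = (\<Sum>v\<in>e. single v (1::nat))" for e :: "vertex set"
  have e: "h (edge_e r l) = g (l - 1) + g l" if "l \<in> {1..2*r-2}" for l
    using edge_e_path_vertex[OF r that] by (simp add: h_def g_def)
  have a: "h (edge_a k) = single (X 1) 1 + single (Y k) 1" and b: "h (edge_b k) = single (X 2) 1 + single (Y k) 1" for k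
    by (simp_all add: h_def edge_a_def edge_b_def)
  have im: "mono_image (sqfree A) = sum h A" if "finite A" for A
    using that by (simp add: mono_image_sqfree h_def)
  show ?thesis
  proof (cases "j = 0")
    case True
    have evens: "sum h ((\<lambda>k. edge_e r (2 * k)) ` {1..r-1}) = (\<Sum>k=1..r-1. g (2*k-1) + g (2*k))"
      by (subst sum.reindex[OF inj_on_edge_e(1)[OF r]]) (auto simp: e intro!: sum.cong)
    have odds: "sum h ((\<lambda>k. edge_e r (2 * k - 1)) ` {1..r-1}) = (\<Sum>k=1..r-1. g (2*k-2) + g (2*k-1))"
    proof -
      have "h (edge_e r (2 * k - 1)) = g (2 * k - 2) + g (2 * k - 1)" if "k \<in> {1..r-1}" for k
      proof -
        have "2 * k - 1 \<in> {1..2*r-2}" using that unfolding atLeastAtMost_iff by linarith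
        from e[OF this] show ?thesis by (simp add: diff_diff_eq numeral_2_eq_2)
      qed
      then show ?thesis
        by (subst sum.reindex[OF inj_on_edge_e(2)[OF r]]) (auto intro!: sum.cong)
    qed
    let ?E = "(\<lambda>k. edge_e r (2 * k)) ` {1..r-1}" and ?O = "(\<lambda>k. edge_e r (2 * k - 1)) ` {1..r-1}"
    have ends: "g 0 = single (X 1) 1" "g (2*(r-1)) = single (X 2) 1"
      using r by (auto simp: g_def path_vertex_def)
    have path: "single (X 1) 1 + sum h ?E = single (X 2) 1 + sum h ?O"
      unfolding evens odds ends[symmetric] by (rule alternate_path_sums)
    have new: "edge_a i \<notin> ?E" "edge_b i \<notin> ?O" by (auto simp: edge_neq)
    have "sum h (partner_edges r x) = single (Y i) 1 + (single (X 2) 1 + sum h ?O)"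
      using new True by (simp add: xij partner_edges_def b ac_simps del: One_nat_def)
    also have "\<dots> = single (Y i) 1 + (single (X 1) 1 + sum h ?E)"
      by (simp only: path)
    also have "\<dots> = sum h (gen_edges r x)"
      using new True by (simp add: xij gen_edges_def gen_tail_def a ac_simps del: One_nat_def)
    finally show ?thesis by (simp add: im finite_partner_edges finite_gen_edges)
  next
    case False
    then show ?thesis
      by (simp add: im xij gen_edges_def gen_tail_def partner_edges_def a b edge_neq ac_simps)
  qed
qed

text \<open>The partner has the same degree and contains \<open>b\<^sub>i\<close>, while the generator contains no \<open>b\<^sub>k\<close> with \<open>k \<ge> i\<close>.\<close>

lemma partner_less:
  assumes r: "r \<ge> 3" and x: "x \<in> gen_idx d"
  shows "G_less r d (sqfree (partner_edges r x)) (gen r x)"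
proof -
  obtain i j where xij: "x = (i, j)" by (cases x)
  have ij: "j < i" "i \<le> d" using x by (auto simp: xij gen_idx_def)
  have b: "edge_b k \<in> partner_edges r (i, j) \<longleftrightarrow> k = i" for k
    by (auto simp: partner_edges_def edge_neq)
  have "mdeg (sqfree (partner_edges r x)) = mdeg (gen r x)"
  proof (cases "j = 0")
    case True
    have "card ((\<lambda>k. edge_e r (2 * k - 1)) ` {1..r-1}) = r - 1"
      using card_image[OF inj_on_edge_e(2)[OF r]] by simp
    moreover have "edge_b i \<notin> (\<lambda>k. edge_e r (2 * k - 1)) ` {1..r-1}" by (auto simp: edge_neq)
    ultimately show ?thesis
      using True r unfolding xij mdeg_gen[OF r] unfolding mdeg_sqfree by (simp add: partner_edges_def)
  next
    case False
    then show ?thesis using False unfolding xij mdeg_gen[OF r] unfolding mdeg_sqfree by (simp add: partner_edges_def edge_neq)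
  qed
  then show ?thesis
    using ij unfolding xij
    by (intro G_less_by_b[where i = i])
      (auto simp: lookup_sqfree finite_partner_edges finite_gen_edges b edge_b_in_gen_edges)
qed

lemma keys_partner: "x \<in> gen_idx d \<Longrightarrow> keys (sqfree (partner_edges r x)) \<subseteq> G_edges r d"
proof -
  assume x: "x \<in> gen_idx d"
  have "edge_e r (2 * k - 1) \<in> edge_e r ` {1..2*r-2}" if "k \<in> {1..r-1}" for k
    using that unfolding atLeastAtMost_iff by (intro imageI) (simp, linarith)
  then have "(\<lambda>k. edge_e r (2 * k - 1)) ` {1..r-1} \<subseteq> G_edges r d"
    unfolding G_edges_def by blast
  moreover have "edge_b (fst x) \<in> G_edges r d" "snd x \<noteq> 0 \<Longrightarrow> edge_a (snd x) \<in> G_edges r d"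
    using x by (auto simp: gen_idx_def G_edges_def)
  ultimately show ?thesis
    by (simp add: keys_sqfree finite_partner_edges partner_edges_def)
qed

text \<open>The heart of the computation of the initial ideal. Let \<open>s\<close> be smaller than \<open>t\<close> in the same fibre.
  If no \<open>b\<close>-exponent changes, the degree conditions force \<open>s = t\<close>. Otherwise let \<open>b\<^sub>i\<close> be the last one that
  changes. It grows, so \<open>a\<^sub>i\<close> shrinks and occurs in \<open>t\<close>. Either some \<open>b\<^sub>j\<close> with \<open>j < i\<close> occurs in
  \<open>t\<close>, and \<open>a\<^sub>i b\<^sub>j\<close> divides \<open>t\<close>; or no \<open>b\<close>-exponent shrinks. Then the degree condition at \<open>x\<^sub>2\<close> makes the
  exponent of \<open>e\<^sub>2\<^sub>r\<^sub>-\<^sub>2\<close> shrink. The conditions along the path propagate this with alternating sign, so the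
  exponents of all even edges shrink, and \<open>a\<^sub>i e\<^sub>2 e\<^sub>4 \<dots> e\<^sub>2\<^sub>r\<^sub>-\<^sub>2\<close> divides \<open>t\<close>.\<close>

lemma nonminimal_divisible:
  assumes r: "r \<ge> 3" and s: "keys s \<subseteq> G_edges r d" and t: "keys t \<subseteq> G_edges r d"
    and im: "mono_image s = mono_image t" and less: "G_less r d s t"
  shows "\<exists>x\<in>gen_idx d. mdvd (gen r x) t"
proof -
  let ?a = "\<lambda>u k. lookup u (edge_a k)" and ?b = "\<lambda>u k. lookup u (edge_b k)"
    and ?e = "\<lambda>u l. lookup u (edge_e r l)"
  have ab: "?a s k + ?b s k = ?a t k + ?b t k" if "k \<in> {1..d}" for k
    using lookup_mono_image_G(1)[OF r s that] lookup_mono_image_G(1)[OF r t that] im by simp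
  have ee: "?e s l + ?e s (Suc l) = ?e t l + ?e t (Suc l)" if "l \<in> {1..2*r-3}" for l
    using lookup_mono_image_G(2)[OF r s that] lookup_mono_image_G(2)[OF r t that] im by simp
  have x2: "(\<Sum>k=1..d. ?b s k) + ?e s (2*r-2) = (\<Sum>k=1..d. ?b t k) + ?e t (2*r-2)"
    using lookup_mono_image_G(3)[OF r s] lookup_mono_image_G(3)[OF r t] im by simp
  \<comment> \<open>The change of the exponent of \<open>e\<^sub>l\<close>; it alternates in sign along the path.\<close>
  define D where "D l = int (?e s l) - int (?e t l)" for l
  have D_step: "D (Suc l) = - D l" if "l \<in> {1..2*r-3}" for l
    using ee[OF that] by (simp add: D_def)
  have D_last: "D l = (if even l then D (2*r-2) else - D (2*r-2))" if "l \<in> {1..2*r-2}" for l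
  proof -
    have D1: "D l = (if even l then - D 1 else D 1)" if "l \<in> {1..2*r-2}" for l
      using that
    proof (induction l)
      case (Suc l)
      show ?case
      proof (cases "l = 0")
        case False
        then show ?thesis using Suc D_step[of l] by auto
      qed simp
    qed simp
    have "2*r-2 \<in> {1..2*r-2}" "even (2*r-2)" using r by auto
    then show ?thesis using D1[OF that] D1[of "2*r-2"] by simp
  qed
  \<comment> \<open>Every edge has two vertices, so the image has twice the degree.\<close>
  have "mdeg s = mdeg t"
  proof -
    have "\<forall>e\<in>G_edges r d. card e = 2"
      using G_simple_graph[OF r, of d] by (simp add: simple_graph_def)
    then have "2 * mdeg s = 2 * mdeg t"
      using mdeg_mono_image[of s] mdeg_mono_image[of t] s t im by (metis subsetD)
    then show ?thesis by simp
  qed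
  from less this show ?thesis
  proof (cases rule: G_less_same_degree_cases)
    case (b i)
    have a_i: "edge_a i \<in> keys t" using ab[OF b(1)] b(2) by (simp add: in_keys_iff)
    show ?thesis
    proof (cases "\<exists>j\<in>{1..<i}. edge_b j \<in> keys t")
      case True
      then obtain j where j: "j \<in> {1..<i}" "edge_b j \<in> keys t" by blast
      then have "mdvd (gen r (i, j)) t"
        using a_i unfolding mdvd_sqfree_iff[OF finite_gen_edges] by (simp add: gen_edges_def gen_tail_def)
      moreover have "(i, j) \<in> gen_idx d" using j b(1) by (simp add: gen_idx_def)
      ultimately show ?thesis by blast
    next
      case False
      have "?b t k \<le> ?b s k" if "k \<in> {1..d}" for k
      proof (cases k i rule: linorder_cases)
        case less
        then have "?b t k = 0" using False that by (auto simp: in_keys_iff)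
        then show ?thesis by simp
      qed (use b that in auto)
      then have "(\<Sum>k=1..d. ?b t k) < (\<Sum>k=1..d. ?b s k)"
        using b(1,2) by (intro sum_strict_mono_ex1) auto
      \<comment> \<open>The \<open>b\<close>-exponents at \<open>x\<^sub>2\<close> have grown in total, so the only other edge there must lose.\<close>
      then have neg: "D (2*r-2) < 0" using x2 by (simp add: D_def)
      have "gen_tail r 0 \<subseteq> keys t"
      proof (clarsimp simp: gen_tail_def)
        fix k assume "Suc 0 \<le> k" "k \<le> r - Suc 0"
        then have "D (2*k) < 0" using D_last[of "2*k"] neg by auto
        then show "edge_e r (2 * k) \<in> keys t" by (auto simp: D_def in_keys_iff)
      qed
      then have "mdvd (gen r (i, 0)) t"
        using a_i unfolding mdvd_sqfree_iff[OF finite_gen_edges] by (simp add: gen_edges_def)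
      moreover have "(i, 0) \<in> gen_idx d" using b(1) by (simp add: gen_idx_def)
      ultimately show ?thesis by blast
    qed
  next
    case (a_e e)
    have a_eq: "?a s k = ?a t k" if "k \<in> {1..d}" for k using ab[OF that] a_e(3)[OF that] by simp
    have "(\<Sum>k=1..d. ?b s k) = (\<Sum>k=1..d. ?b t k)" using a_e(3) by (intro sum.cong) auto
    then have "D (2*r-2) = 0" using x2 by (simp add: D_def)
    then have e_eq: "?e s l = ?e t l" if "l \<in> {1..2*r-2}" for l
      using D_last[OF that] by (simp add: D_def split: if_splits)
    have "lookup s e = lookup t e"
      using a_e(1) unfolding G_edges_def by (auto intro: a_eq a_e(3) e_eq)
    then show ?thesis using a_e(2) by simp
  qed
qed

lemma in_I_eq:
  assumes r: "r \<ge> 3"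
  shows "in_I r d = Idl\<^bsub>poly_ring (G_edges r d)\<^esub> (monom ` gen r ` gen_idx d :: (vertex set, 'k::field) mpoly set)"
  unfolding in_I_def
proof (rule initial_ideal_toric_eq)
  show "\<exists>s. keys s \<subseteq> G_edges r d \<and> mono_image s = mono_image m \<and> G_less r d s m"
    if "m \<in> gen r ` gen_idx d" for m
    using that mono_image_partner[OF r] partner_less[OF r] keys_partner by blast
  show "\<exists>m\<in>gen r ` gen_idx d. mdvd m t"
    if "keys s \<subseteq> G_edges r d" "keys t \<subseteq> G_edges r d" "mono_image s = mono_image t" "G_less r d s t" for s t
    using nonminimal_divisible[OF r that] by blast
qed (use G_less_asym keys_gen in blast)+

section \<open>The ordered list of generators\<close>

lemma sorted_wrt_concat_map:
  assumes "\<And>x. x \<in> set xs \<Longrightarrow> sorted_wrt P (f x)"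
    and "sorted_wrt (\<lambda>x y. \<forall>a\<in>set (f x). \<forall>b\<in>set (f y). P a b) xs"
  shows "sorted_wrt P (concat (map f xs))"
  using assms by (induction xs) (auto simp: sorted_wrt_append)

lemma distinct_if_sorted_wrt: "(\<And>x. \<not> P x x) \<Longrightarrow> sorted_wrt P xs \<Longrightarrow> distinct xs"
  by (induction xs) auto

text \<open>Replaces positions in the list by the order, so that quotients can be computed from index pairs.\<close>

lemma set_take_sorted_wrt:
  assumes asym: "\<And>x y. P x y \<Longrightarrow> \<not> P y x" and sorted: "sorted_wrt P xs" and n: "n < length xs"
  shows "set (take n xs) = {x \<in> set xs. P x (xs ! n)}"
proof -
  have "P (xs ! i) (xs ! n) \<longleftrightarrow> i < n" if "i < length xs" for i
    using sorted n that asym[of "xs ! n" "xs ! i"] asym[of "xs ! n" "xs ! n"]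
    unfolding sorted_wrt_iff_nth_less by (cases i n rule: linorder_cases) auto
  moreover have "set (take n xs) = {xs ! i | i. i < n}"
    unfolding nth_image[OF less_imp_le[OF n], symmetric] by auto
  ultimately show ?thesis using n by (auto simp: set_conv_nth)
qed

text \<open>Block \<open>q\<close> holds the \<open>q\<close> generators with \<open>j = d - q\<close>, in decreasing order of \<open>i\<close>; the last block
  \<open>q = d\<close> consists of the generators of degree \<open>r\<close>.\<close>

definition gen_list :: "nat \<Rightarrow> (nat \<times> nat) list" where
  "gen_list d = concat (map (\<lambda>q. map (\<lambda>k. (d - k, d - q)) [0..<q]) [1..<Suc d])"

lemma set_gen_list: "set (gen_list d) = gen_idx d"
proof
  show "gen_idx d \<subseteq> set (gen_list d)"
  proof
    fix x assume "x \<in> gen_idx d"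
    then obtain i j where x: "x = (i, j)" "j < i" "i \<le> d" by (auto simp: gen_idx_def)
    then have "d - j \<in> {1..d}" "d - i \<in> {0..<d - j}" "x = (d - (d - i), d - (d - j))" by auto
    then show "x \<in> set (gen_list d)" by (force simp: gen_list_def simp del: upt_Suc)
  qed
qed (auto simp: gen_list_def gen_idx_def simp del: upt_Suc)

lemma listed_before_asym: "listed_before x y \<Longrightarrow> \<not> listed_before y x"
  by (auto simp: listed_before_def)

lemma sorted_gen_list: "sorted_wrt listed_before (gen_list d)"
  unfolding gen_list_def
proof (rule sorted_wrt_concat_map)
  show "sorted_wrt listed_before (map (\<lambda>k. (d - k, d - q)) [0..<q])" if "q \<in> set [1..<Suc d]" for q
    using that by (auto simp: sorted_wrt_iff_nth_less listed_before_def simp del: upt_Suc)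
  show "sorted_wrt (\<lambda>p q. \<forall>x\<in>set (map (\<lambda>k. (d - k, d - p)) [0..<p]).
      \<forall>y\<in>set (map (\<lambda>k. (d - k, d - q)) [0..<q]). listed_before x y) [1..<Suc d]"
    by (auto simp: sorted_wrt_iff_nth_less listed_before_def simp del: upt_Suc)
qed

lemma length_gen_list: "length (gen_list d) = d * (d + 1) div 2"
proof -
  have "length (gen_list d) = (\<Sum>q=1..<Suc d. q)"
    by (simp add: gen_list_def length_concat comp_def interv_sum_list_conv_sum_set_nat del: upt_Suc)
  also have "\<dots> = (\<Sum>q=0..d. q)" by (intro sum.mono_neutral_left) auto
  also have "\<dots> = d * (d + 1) div 2" by (simp add: gauss_sum_nat)
  finally show ?thesis .
qed

lemma gens_in_I_eq:
  assumes r: "r \<ge> 3"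
  shows "gens_in_I r d = (map monom (map (gen r) (gen_list d)) :: (vertex set, 'k::field) mpoly list)"
    and "minimal_gen_set (poly_ring (G_edges r d)) (in_I r d)
      (set (map monom (map (gen r) (gen_list d))) :: (vertex set, 'k) mpoly set)"
proof -
  have min: "minimal_gen_set (poly_ring (G_edges r d)) (in_I r d)
      (monom ` gen r ` gen_idx d :: (vertex set, 'k) mpoly set)"
    unfolding in_I_eq[OF r]
    using keys_gen gen_antichain[OF r] by (intro antichain_minimal_gen_set) blast+
  have "sorted_wrt (G_less r d) (map (gen r) (gen_list d))"
    unfolding sorted_wrt_map
    by (rule sorted_wrt_mono_rel[OF _ sorted_gen_list]) (use gen_sorted[OF r] set_gen_list in blast)
  then show "gens_in_I r d = (map monom (map (gen r) (gen_list d)) :: (vertex set, 'k) mpoly list)"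
    unfolding gens_in_I_def using min
    by (intro sorted_mono_gens_eqI) (auto simp: set_gen_list dest: G_less_asym)
  show "minimal_gen_set (poly_ring (G_edges r d)) (in_I r d)
      (set (map monom (map (gen r) (gen_list d))) :: (vertex set, 'k) mpoly set)"
    using min by (simp add: set_gen_list image_image)
qed

section \<open>The quotients\<close>

definition quotient_vars :: "nat \<Rightarrow> nat \<times> nat \<Rightarrow> vertex set set" where
  "quotient_vars d x = edge_a ` {fst x<..d} \<union> edge_b ` {snd x<..<fst x}"

lemma quotient_vars_subset: "x \<in> gen_idx d \<Longrightarrow> quotient_vars d x \<subseteq> G_edges r d"
  by (auto simp: quotient_vars_def gen_idx_def G_edges_def)

lemma card_quotient_vars:
  assumes "(i, j) \<in> gen_idx d" shows "card (quotient_vars d (i, j)) = d - j - 1"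
proof -
  have "card (quotient_vars d (i, j)) = card (edge_a ` {i<..d}) + card (edge_b ` {j<..<i})"
    unfolding quotient_vars_def fst_conv snd_conv by (rule card_Un_disjoint) (auto simp: edge_neq)
  also have "\<dots> = (d - i) + (i - j - 1)"
    by (simp add: card_image inj_on_def edge_neq)
  finally show ?thesis using assms by (auto simp: gen_idx_def)
qed

text \<open>The generators of the quotient by \<open>a\<^sub>i c\<^sub>j\<close>. An earlier generator \<open>a\<^sub>i\<^sub>' c\<^sub>j\<^sub>'\<close> with \<open>i' > i\<close> contributes a
  multiple of \<open>a\<^sub>i\<^sub>'\<close>, which is itself contributed by \<open>a\<^sub>i\<^sub>' c\<^sub>j\<close>. If \<open>i' \<le> i\<close>, then \<open>j < j' < i' \<le> i\<close> and the
  contribution is a multiple of \<open>b\<^sub>j\<^sub>'\<close>, which is itself contributed by \<open>a\<^sub>i b\<^sub>j\<^sub>'\<close>; here \<open>j' \<ge> 1\<close>, so the tail is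
  a single variable.\<close>

lemma divisible_iff_quotient_var:
  assumes x: "x \<in> gen_idx d"
  shows "(\<exists>m \<in> gen r ` {y \<in> gen_idx d. listed_before y x}. mdvd m (t + gen r x)) \<longleftrightarrow>
    (\<exists>v \<in> quotient_vars d x. v \<in> keys t)"
proof -
  obtain i j where xij: "x = (i, j)" by (cases x)
  have ij: "j < i" "i \<le> d" using x by (auto simp: xij gen_idx_def)
  have dvd: "mdvd (gen r y) (t + gen r x) \<longleftrightarrow> gen_edges r y - gen_edges r x \<subseteq> keys t" for y
    by (simp add: mdvd_sqfree_add_iff finite_gen_edges)
  show ?thesis
  proof
    assume "\<exists>m \<in> gen r ` {y \<in> gen_idx d. listed_before y x}. mdvd m (t + gen r x)"
    then obtain y where "y \<in> gen_idx d" "listed_before y x" "gen_edges r y - gen_edges r x \<subseteq> keys t"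
      by (auto simp: dvd)
    moreover obtain i' j' where "y = (i', j')" by (cases y)
    ultimately have y: "j' < i'" "i' \<le> d" "listed_before (i', j') (i, j)"
      and sub: "gen_edges r (i', j') - gen_edges r (i, j) \<subseteq> keys t"
      by (auto simp: gen_idx_def xij)
    show "\<exists>v \<in> quotient_vars d x. v \<in> keys t"
    proof (cases "i < i'")
      case True
      then have "edge_a i' \<in> gen_edges r (i', j') - gen_edges r (i, j)"
        by (simp add: edge_a_in_gen_edges)
      moreover have "edge_a i' \<in> quotient_vars d x" using True y by (simp add: quotient_vars_def xij)
      ultimately show ?thesis using sub by blast
    next
      case False
      then have j': "j < j'" "j' < i" using y by (auto simp: listed_before_def)
      then have "edge_b j' \<in> gen_edges r (i', j') - gen_edges r (i, j)"
        by (simp add: edge_b_in_gen_edges)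
      moreover have "edge_b j' \<in> quotient_vars d x" using j' by (simp add: quotient_vars_def xij)
      ultimately show ?thesis using sub by blast
    qed
  next
    assume "\<exists>v \<in> quotient_vars d x. v \<in> keys t"
    then consider i' where "i < i'" "i' \<le> d" "edge_a i' \<in> keys t"
      | j' where "j < j'" "j' < i" "edge_b j' \<in> keys t"
      by (auto simp: quotient_vars_def xij)
    then show "\<exists>m \<in> gen r ` {y \<in> gen_idx d. listed_before y x}. mdvd m (t + gen r x)"
    proof cases
      case 1
      then have "mdvd (gen r (i', j)) (t + gen r x)"
        unfolding dvd by (auto simp: xij gen_edges_def)
      moreover have "(i', j) \<in> {y \<in> gen_idx d. listed_before y x}" using 1 ij by (simp add: gen_idx_def listed_before_def xij)
      ultimately show ?thesis by blast
    next
      case 2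
      then have "mdvd (gen r (i, j')) (t + gen r x)"
        unfolding dvd by (auto simp: xij gen_edges_def gen_tail_def)
      moreover have "(i, j') \<in> {y \<in> gen_idx d. listed_before y x}" using 2 ij by (simp add: gen_idx_def listed_before_def xij)
      ultimately show ?thesis by blast
    qed
  qed
qed

lemma nth_gen_list:
  assumes "p \<in> {1..length (gen_list d)}"
  shows "gen_list d ! (p - 1) \<in> gen_idx d"
proof -
  have "p - 1 < length (gen_list d)" using assms by auto
  then show ?thesis unfolding set_gen_list[symmetric] by (rule nth_mem)
qed

lemma step_quotient_eq:
  assumes p: "p \<in> {1..length (gen_list d)}"
  shows "step_quotient (poly_ring (G_edges r d)) (map monom (map (gen r) (gen_list d))) p =
    Idl\<^bsub>poly_ring (G_edges r d)\<^esub> (Var ` quotient_vars d (gen_list d ! (p - 1)) :: (vertex set, 'k::field) mpoly set)"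
proof -
  define x where "x = gen_list d ! (p - 1)"
  have x: "x \<in> gen_idx d" unfolding x_def using p by (rule nth_gen_list)
  have n: "p - 1 < length (gen_list d)" using p by auto
  have take_eq: "set (take (p - 1) (map monom (map (gen r) (gen_list d)))) =
      (monom ` gen r ` {y \<in> gen_idx d. listed_before y x} :: (vertex set, 'k) mpoly set)"
    using set_take_sorted_wrt[OF listed_before_asym sorted_gen_list n]
    by (simp add: take_map set_gen_list x_def image_image)
  have nth_eq: "map monom (map (gen r) (gen_list d)) ! (p - 1) = (monom (gen r x) :: (vertex set, 'k) mpoly)"
    using n by (simp add: x_def)
  have keysM: "\<forall>m \<in> gen r ` {y \<in> gen_idx d. listed_before y x}. keys m \<subseteq> G_edges r d"
    using keys_gen by blast
  show ?thesis
    unfolding step_quotient_def take_eq nth_eq x_def[symmetric]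
    by (rule monomial_quotient_eq_variables[OF keysM keys_gen[OF x]
        quotient_vars_subset[OF x] divisible_iff_quotient_var[OF x]])
qed

theorem theorem3p6:
  fixes r d :: nat
  assumes "r \<ge> 3" and "d \<ge> 2"
  shows "let R = (poly_ring (G_edges r d) :: (vertex set, 'k::field) mpoly ring);
             m = (gens_in_I r d :: (vertex set, 'k) mpoly list)
         in length m = d * (d + 1) div 2 \<and>
            has_linear_quotients (G_edges r d) (in_I r d) m \<and>
            map (\<lambda>p. min_num_gens R (step_quotient R m p)) [1..<Suc (d * (d + 1) div 2)]
              = concat (map (\<lambda>q. replicate q (q - 1)) [1..<Suc d])"
proof -
  define R where "R = (poly_ring (G_edges r d) :: (vertex set, 'k) mpoly ring)"
  define m where "m = (gens_in_I r d :: (vertex set, 'k) mpoly list)"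
  note m_eq = gens_in_I_eq[OF assms(1), of d, where 'k='k, folded m_def]
  have len: "length m = length (gen_list d)" by (simp add: m_eq)
  have linear: "Var ` quotient_vars d x \<subseteq> (linear_forms (G_edges r d) :: (vertex set, 'k) mpoly set)"
    if "x \<in> gen_idx d" for x
    using quotient_vars_subset[OF that, of r] by (auto simp: linear_forms_def Var_def)
  have "distinct m"
  proof -
    have "distinct (gen_list d)"
      using listed_before_asym by (intro distinct_if_sorted_wrt[OF _ sorted_gen_list]) blast
    moreover have "inj_on (gen r) (gen_idx d)"
    proof (rule inj_onI)
      fix x y assume "x \<in> gen_idx d" "y \<in> gen_idx d" "gen r x = gen r y"
      then show "x = y" using gen_antichain[OF assms(1), of x d y] mdvd_refl[of "gen r x"] by simp
    qed
    moreover have "inj_on (monom :: _ \<Rightarrow> (vertex set, 'k) mpoly) (gen r ` gen_idx d)"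
      by (rule inj_on_subset[OF inj_monom subset_UNIV])
    ultimately show ?thesis
      unfolding m_eq(1) distinct_map set_map set_gen_list by blast
  qed
  moreover have "is_homogeneous f" if "f \<in> set m" for f
    using that by (auto simp: m_eq is_homogeneous_def)
  moreover have "\<exists>L \<subseteq> linear_forms (G_edges r d). step_quotient R m p = Idl\<^bsub>R\<^esub> L"
    if "p \<in> {2..length m}" for p
    using that step_quotient_eq[of p d r, where 'k='k] linear[OF nth_gen_list] unfolding R_def m_eq(1)
    by (intro exI[of _ "Var ` quotient_vars d (gen_list d ! (p - 1))"]) auto
  ultimately have lin: "has_linear_quotients (G_edges r d) (in_I r d) m"
    using m_eq by (simp add: has_linear_quotients_def R_def)
  have num: "min_num_gens R (step_quotient R m p) = d - snd (gen_list d ! (p - 1)) - 1"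
    if "p \<in> {1..length (gen_list d)}" for p
  proof -
    have "min_num_gens R (step_quotient R m p) = card (quotient_vars d (gen_list d ! (p - 1)))"
      unfolding R_def m_eq(1) step_quotient_eq[OF that]
      using quotient_vars_subset[OF nth_gen_list[OF that]]
      by (intro min_num_gens_variables) (simp_all add: quotient_vars_def)
    then show ?thesis
      using card_quotient_vars[of "fst (gen_list d ! (p - 1))" "snd (gen_list d ! (p - 1))" d]
        nth_gen_list[OF that] by simp
  qed
  have "map (\<lambda>p. min_num_gens R (step_quotient R m p)) [1..<Suc (length (gen_list d))] =
      map (\<lambda>x. d - snd x - 1) (gen_list d)"
    by (rule nth_equalityI) (auto simp: num simp del: upt_Suc)
  \<comment> \<open>In block \<open>q\<close> the index \<open>j\<close> is \<open>d - q\<close>.\<close>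
  also have "\<dots> = concat (map (\<lambda>q. map (\<lambda>k. d - (d - q) - 1) [0..<q]) [1..<Suc d])"
    by (simp add: gen_list_def map_concat comp_def del: upt_Suc)
  also have "\<dots> = concat (map (\<lambda>q. replicate q (q - 1)) [1..<Suc d])"
    by (intro arg_cong[of _ _ concat] map_cong refl) (auto simp: map_replicate_const simp del: upt_Suc)
  finally show ?thesis
    using lin len by (simp add: Let_def R_def m_def length_gen_list del: upt_Suc)
qed

end
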